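(* Consider the multi-stage stochastic capacity expansion problem for shared autonomous vehicle (SAV) systems described in the context. Suppose that the realizations of $\xi^{\rm F}$ and $\xi^{\rm G}$ are mutually independent (stagewise independent) and that the conditional risk measure is the conditional expectation, $\mathbb F_\xi=\mathbb E_\xi$. Let $(\kappa^*,\hat\kappa^*,z^*,\dots)$ be an optimal solution and let $p^{t,*}_{s,ij}$ denote the optimal dual variables corresponding to the capacity constraints $z^t_{s,ij}\le\kappa_{s,ij}$. Then for every $ij$, $$\mathbb E\Big[\sum_{s\in\mathcal S^{\rm F}}\big(c_{s,ij}\kappa^*_{s,ij}+\hat c_{s,ij}\hat\kappa^*_{s,ij}\big)\Big]=\mathbb E\Big[\sum_{s\in\mathcal S^{\rm G}}\sum_tp^{t,*}_{s,ij}z^{t,*}_{s,ij}\Big],$$ where $\mathbb E$ is the expectation over all uncertainties over the planning horizon; that is, the expected total infrastructure expansion and maintenance cost of $ij$ equals the expected total of the payments $p^{t,*}_{s,ij}z^{t,*}_{s,ij}$ by SAVs on $ij$.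
   Context: **Structure.** Let $S=2\tau$ with $\tau$ finite and given, $\mathcal S^{\rm F}=\{1,3,\dots,S-1\}$ (strategic stages), $\mathcal S^{\rm G}=\{2,4,\dots,S\}$ (operational stages). The uncertainty $\xi_s$ ($\xi^{\rm F}_s$ if $s\in\mathcal S^{\rm F}$, $\xi^{\rm G}_s$ if $s\in\mathcal S^{\rm G}$) is revealed at the beginning of stage $s$ and has finitely many realizations. With initial state $x_0$ and $\xi_1$ given, the problem is $$\min C^{\rm F}_1+\mathbb F_{\xi_1}[\min C_2^{\rm G}+\mathbb F_{\xi_2}[\min C_3^{\rm F}+\cdots+\mathbb F_{\xi_{S-1}}[\min C^{\rm G}_S]]],$$ where at each stage the minimization is over the stage's state and decision variables given the incoming state and the observed uncertainty, and $\mathbb F_{\xi_s}$ is a conditional risk measure. **Variables** (all nonnegative and continuous). $ij$ ranges over links ($i\ne j$) and nodes ($i=j$). State $x_s$: capacities $\kappa_{s,ij}$ (traffic capacity of link $ij$, or storage capacity of node $i$ if $i=j$) and expected demands $Q^l_{s,od}$ (origin $o$, destination $d$, desired arrival time step $l$). Strategic decisions: capacity expansions $\hat\kappa_{s,ij}$. Operational decisions: SAV flow $z^t_{s,ij}$ starting on $ij$ at time step $t$; SAVs $\hat z_{s,i}$ deployed at node $i$; traveler flow $y^{l,t}_{s,d,ij}$; traveler arrivals $q^{l,t}_{s,d}$. **Strategic stages** $s\in\mathcal S^{\rm F}$. Cost $C^{\rm F}_s=\sum_{ij}(\hat c_{s,ij}\hat\kappa_{s,ij}+c_{s,ij}\kappa_{s,ij})$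 (expansion and maintenance). Transition: $\kappa_{s,ij}=\kappa_{s-1,ij}+\hat\kappa_{s,ij}$ and $Q^l_{s,od}=Q^l_{s-1,od}-\phi^l_{od}(Q^l_{s-1,od}-\mu^l_{od})+\xi^{l,{\rm F}}_{s,od}$ (mean-reverting, long-term mean $\mu$, reverting speed $\phi$). **Operational stages** $s\in\mathcal S^{\rm G}$. Transition: $\kappa_s=\kappa_{s-1}$, $Q_s=Q_{s-1}$. Cost $$C^{\rm G}_s=\sum_{t,d,l,ij}f_{s,ij}y^{l,t}_{s,d,ij}+\epsilon_s\sum_{d,l}\sum_{t<l}q^{l,t}_{s,d}+\lambda_s\sum_{d,l}\sum_{t>l}q^{l,t}_{s,d}+\sum_{t,ij}d_{s,ij}z^t_{s,ij}+d_s\sum_i\hat z_{s,i}.$$ Constraints ($\delta$ is Kronecker's delta, $t_{ij}$ the free-flow travel time of link $ij$ or the waiting time if $i=j$, $\rho$ the passenger capacity of an SAV): - $\sum_jz^{t-t_{ji}}_{s,ji}=\sum_jz^t_{s,ij}-\delta_{t1}\hat z_{s,i}$ for all $t,i$; - $\sum_jy^{l,t-t_{ji}}_{s,d,ji}=\sum_jy^{l,t}_{s,d,ij}+\delta_{id}q^{l,t}_{s,d}$ for all $t,d,l,i$; - $\sum_tq^{l,t}_{s,d}=\sum_o(Q^l_{s,od}+\xi^{l,{\rm G}}_{s,od})$ for all $d,l$; - $\sum_{d,l}y^{l,t}_{s,d,ij}\le\rho z^t_{s,ij}$ for all $t,ij$; - $z^t_{s,ij}\le\kappa_{s,ij}$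 for all $t,ij$ (capacity constraint). **Dual variables.** In the risk-neutral case the problem is a multi-stage stochastic linear program on a finite scenario tree. $p^t_{s,ij}\ge0$ is the multiplier of the capacity constraint at each scenario-tree node, normalized by the node probability (i.e. the Lagrangian contains $\mathbb E[\sum_{s,t,ij}p^t_{s,ij}(z^t_{s,ij}-\kappa_{s,ij})]$).
   Formalization: The formal statement additionally assumes that the given initial capacity of the arc ij in question is zero (κ_{0,ij} = 0); without this the identity fails, e.g. with no demand, κ_{0,ij} = 1 and positive maintenance cost. *)

theory Defs
  imports "HOL-Probability.Probability"
begin

text \<open>
  Time steps of an operational stage are the integers \<open>1..horizon\<close>; an arc is a link
  \<open>(i, j)\<close> with \<open>i \<noteq> j\<close>, or \<open>(i, i)\<close> for the node \<open>i\<close>. Index order is that of the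
  superscripts followed by the subscripts, e.g. \<open>Q l o d\<close> and \<open>y l t d (i, j)\<close>.
\<close>

type_synonym 'n demand = "int \<Rightarrow> 'n \<Rightarrow> 'n \<Rightarrow> real"

record 'n state =
  cap :: "'n \<times> 'n \<Rightarrow> real"
  dem :: "'n demand"

record 'n decision =
  expansion :: "'n \<times> 'n \<Rightarrow> real"
  sav_flow :: "int \<Rightarrow> 'n \<times> 'n \<Rightarrow> real"
  deployed :: "'n \<Rightarrow> real"
  trav_flow :: "int \<Rightarrow> int \<Rightarrow> 'n \<Rightarrow> 'n \<times> 'n \<Rightarrow> real"
  arrivals :: "int \<Rightarrow> int \<Rightarrow> 'n \<Rightarrow> real"

text \<open>
  The conservation constraints refer to flows that started at steps \<open>t \<le> 0\<close>. These are data: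
  \<open>pre_sav s t ij\<close> and \<open>pre_trav s D l t d ij\<close>, where \<open>D\<close> gives, for each origin, the realized
  demand of the class \<open>(l, d)\<close>. The zero functions are the convention that there are none;
  nonzero \<open>pre_trav\<close> lets travelers enter the network, as the traveler conservation
  constraint has no source term.
\<close>

record 'n sav_model =
  periods :: nat  \<comment> \<open>\<open>\<tau>\<close>\<close>
  horizon :: nat
  links :: "('n \<times> 'n) set"
  ttime :: "'n \<times> 'n \<Rightarrow> nat"
  rho :: real
  exp_cost :: "nat \<Rightarrow> 'n \<times> 'n \<Rightarrow> real"  \<comment> \<open>\<open>c\<close> with a hat\<close>
  maint_cost :: "nat \<Rightarrow> 'n \<times> 'n \<Rightarrow> real"  \<comment> \<open>\<open>c\<close>\<close>
  trav_cost :: "nat \<Rightarrow> 'n \<times> 'n \<Rightarrow> real"  \<comment> \<open>\<open>f\<close>\<close>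
  early_cost :: "nat \<Rightarrow> real"  \<comment> \<open>\<open>\<epsilon>\<close>\<close>
  late_cost :: "nat \<Rightarrow> real"  \<comment> \<open>\<open>\<lambda>\<close>\<close>
  sav_cost :: "nat \<Rightarrow> 'n \<times> 'n \<Rightarrow> real"  \<comment> \<open>\<open>d\<close> with arc index\<close>
  fleet_cost :: "nat \<Rightarrow> real"  \<comment> \<open>\<open>d\<close> without arc index\<close>
  revert :: "'n demand"  \<comment> \<open>\<open>\<phi>\<close>\<close>
  dem_mean :: "'n demand"  \<comment> \<open>\<open>\<mu>\<close>\<close>
  init_state :: "'n state"  \<comment> \<open>\<open>x\<close> with index 0\<close>
  pre_sav :: "nat \<Rightarrow> int \<Rightarrow> 'n \<times> 'n \<Rightarrow> real"
  pre_trav :: "nat \<Rightarrow> ('n \<Rightarrow> real) \<Rightarrow> int \<Rightarrow> int \<Rightarrow> 'n \<Rightarrow> 'n \<times> 'n \<Rightarrow> real"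

definition stages :: "'n sav_model \<Rightarrow> nat" where
  "stages P = 2 * periods P"

definition strategic :: "'n sav_model \<Rightarrow> nat set" where
  "strategic P = {s \<in> {1..stages P}. odd s}"

definition operational :: "'n sav_model \<Rightarrow> nat set" where
  "operational P = {s \<in> {1..stages P}. even s}"

definition steps :: "'n sav_model \<Rightarrow> int set" where
  "steps P = {1..int (horizon P)}"

definition arcs :: "'n sav_model \<Rightarrow> ('n \<times> 'n) set" where
  "arcs P = {(i, j). i = j \<or> (i, j) \<in> links P}"

definition strategic_cost :: "'n::finite sav_model \<Rightarrow> nat \<Rightarrow> 'n state \<Rightarrow> 'n decision \<Rightarrow> real" where
  "strategic_cost P s x v =
     (\<Sum>ij\<in>arcs P. exp_cost P s ij * expansion v ij + maint_cost P s ij * cap x ij)"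

definition operational_cost :: "'n::finite sav_model \<Rightarrow> nat \<Rightarrow> 'n decision \<Rightarrow> real" where
  "operational_cost P s v =
     (\<Sum>t\<in>steps P. \<Sum>d\<in>UNIV. \<Sum>l\<in>steps P. \<Sum>ij\<in>arcs P. trav_cost P s ij * trav_flow v l t d ij)
     + early_cost P s * (\<Sum>d\<in>UNIV. \<Sum>l\<in>steps P. \<Sum>t\<in>{t \<in> steps P. t < l}. arrivals v l t d)
     + late_cost P s * (\<Sum>d\<in>UNIV. \<Sum>l\<in>steps P. \<Sum>t\<in>{t \<in> steps P. t > l}. arrivals v l t d)
     + (\<Sum>t\<in>steps P. \<Sum>ij\<in>arcs P. sav_cost P s ij * sav_flow v t ij)
     + fleet_cost P s * (\<Sum>i\<in>UNIV. deployed v i)"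

definition stage_cost :: "'n::finite sav_model \<Rightarrow> nat \<Rightarrow> 'n state \<Rightarrow> 'n decision \<Rightarrow> real" where
  "stage_cost P s x v = (if odd s then strategic_cost P s x v else operational_cost P s v)"

definition state_nonneg :: "'n sav_model \<Rightarrow> 'n state \<Rightarrow> bool" where
  "state_nonneg P x \<longleftrightarrow>
     (\<forall>ij\<in>arcs P. 0 \<le> cap x ij) \<and> (\<forall>l\<in>steps P. \<forall>o' d. 0 \<le> dem x l o' d)"

definition strategic_constraints ::
  "'n sav_model \<Rightarrow> 'n state \<Rightarrow> 'n demand \<Rightarrow> 'n state \<Rightarrow> 'n decision \<Rightarrow> bool" where
  "strategic_constraints P x\<^sub>0 u x v \<longleftrightarrow>
     (\<forall>ij\<in>arcs P. 0 \<le> expansion v ij) \<and>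
     (\<forall>ij\<in>arcs P. cap x ij = cap x\<^sub>0 ij + expansion v ij) \<and>
     (\<forall>l\<in>steps P. \<forall>o' d. dem x l o' d =
        dem x\<^sub>0 l o' d - revert P l o' d * (dem x\<^sub>0 l o' d - dem_mean P l o' d) + u l o' d)"

definition sav_at :: "'n sav_model \<Rightarrow> nat \<Rightarrow> 'n decision \<Rightarrow> int \<Rightarrow> 'n \<times> 'n \<Rightarrow> real" where
  "sav_at P s v t ij = (if 1 \<le> t then sav_flow v t ij else pre_sav P s t ij)"

definition trav_at ::
  "'n sav_model \<Rightarrow> nat \<Rightarrow> 'n demand \<Rightarrow> 'n decision \<Rightarrow> int \<Rightarrow> int \<Rightarrow> 'n \<Rightarrow> 'n \<times> 'n \<Rightarrow> real" where
  "trav_at P s D v l t d ij =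
     (if 1 \<le> t then trav_flow v l t d ij else pre_trav P s (\<lambda>o'. D l o' d) l t d ij)"

text \<open>All constraints of an operational stage except the capacity constraint.\<close>

definition operational_constraints ::
  "'n::finite sav_model \<Rightarrow> nat \<Rightarrow> 'n state \<Rightarrow> 'n demand \<Rightarrow> 'n state \<Rightarrow> 'n decision \<Rightarrow> bool" where
  "operational_constraints P s x\<^sub>0 u x v \<longleftrightarrow>
     (\<forall>ij\<in>arcs P. cap x ij = cap x\<^sub>0 ij) \<and>
     (\<forall>l\<in>steps P. \<forall>o' d. dem x l o' d = dem x\<^sub>0 l o' d) \<and>
     (\<forall>t\<in>steps P. \<forall>ij\<in>arcs P. 0 \<le> sav_flow v t ij) \<and>
     (\<forall>i. 0 \<le> deployed v i) \<and>
     (\<forall>l\<in>steps P. \<forall>t\<in>steps P. \<forall>d. \<forall>ij\<in>arcs P. 0 \<le> trav_flow v l t d ij) \<and>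
     (\<forall>l\<in>steps P. \<forall>t\<in>steps P. \<forall>d. 0 \<le> arrivals v l t d) \<and>
     (\<forall>t\<in>steps P. \<forall>i.
        (\<Sum>j | (j, i) \<in> arcs P. sav_at P s v (t - int (ttime P (j, i))) (j, i)) =
        (\<Sum>j | (i, j) \<in> arcs P. sav_flow v t (i, j)) - (if t = 1 then deployed v i else 0)) \<and>
     (\<forall>t\<in>steps P. \<forall>d. \<forall>l\<in>steps P. \<forall>i.
        (\<Sum>j | (j, i) \<in> arcs P.
           trav_at P s (\<lambda>l o' d. dem x l o' d + u l o' d) v l (t - int (ttime P (j, i))) d (j, i)) =
        (\<Sum>j | (i, j) \<in> arcs P. trav_flow v l t d (i, j)) + (if i = d then arrivals v l t d else 0)) \<and>
     (\<forall>d. \<forall>l\<in>steps P.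
        (\<Sum>t\<in>steps P. arrivals v l t d) = (\<Sum>o'\<in>UNIV. dem x l o' d + u l o' d)) \<and>
     (\<forall>t\<in>steps P. \<forall>ij\<in>arcs P.
        (\<Sum>d\<in>UNIV. \<Sum>l\<in>steps P. trav_flow v l t d ij) \<le> rho P * sav_flow v t ij)"

definition capacity_constraint :: "'n sav_model \<Rightarrow> 'n state \<Rightarrow> 'n decision \<Rightarrow> bool" where
  "capacity_constraint P x v \<longleftrightarrow> (\<forall>t\<in>steps P. \<forall>ij\<in>arcs P. sav_flow v t ij \<le> cap x ij)"

text \<open>
  Below, \<open>x\<^sub>0\<close> is the incoming state of stage \<open>s\<close> and \<open>u\<close> the realization of its uncertainty.
\<close>

definition uncapacitated_feasible ::
  "'n::finite sav_model \<Rightarrow> nat \<Rightarrow> 'n state \<Rightarrow> 'n demand \<Rightarrow> 'n state \<Rightarrow> 'n decision \<Rightarrow> bool" where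
  "uncapacitated_feasible P s x\<^sub>0 u x v \<longleftrightarrow> state_nonneg P x \<and>
     (if odd s then strategic_constraints P x\<^sub>0 u x v else operational_constraints P s x\<^sub>0 u x v)"

definition stage_feasible ::
  "'n::finite sav_model \<Rightarrow> nat \<Rightarrow> 'n state \<Rightarrow> 'n demand \<Rightarrow> 'n state \<Rightarrow> 'n decision \<Rightarrow> bool" where
  "stage_feasible P s x\<^sub>0 u x v \<longleftrightarrow>
     uncapacitated_feasible P s x\<^sub>0 u x v \<and> (even s \<longrightarrow> capacity_constraint P x v)"

text \<open>
  \<open>F s u g\<close> is the conditional risk, given that the uncertainty of stage \<open>s\<close> is \<open>u\<close>, of the
  cost \<open>g u'\<close> depending on the uncertainty \<open>u'\<close> of stage \<open>s + 1\<close>. Costs are extended real so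
  that an infeasible continuation costs \<open>\<infinity>\<close>.
\<close>

type_synonym 'n risk_measure = "nat \<Rightarrow> 'n demand \<Rightarrow> ('n demand \<Rightarrow> ereal) \<Rightarrow> ereal"

function nested_value ::
  "'n::finite sav_model \<Rightarrow> 'n risk_measure \<Rightarrow> nat \<Rightarrow> 'n state \<Rightarrow> 'n demand \<Rightarrow> ereal" where
  "nested_value P F s x\<^sub>0 u =
     (INF xv\<in>{(x, v). stage_feasible P s x\<^sub>0 u x v}.
        ereal (stage_cost P s (fst xv) (snd xv)) +
        (if s < stages P then F s u (\<lambda>u'. nested_value P F (Suc s) (fst xv) u') else 0))"
  by auto
termination
  by (relation "Wellfounded.measure (\<lambda>(P, F, s, x\<^sub>0, u). stages P - s)") auto

declare nested_value.simps [simp del]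

definition nested_objective ::
  "'n::finite sav_model \<Rightarrow> 'n risk_measure \<Rightarrow> nat \<Rightarrow> 'n demand \<Rightarrow> 'n state \<Rightarrow> 'n decision \<Rightarrow> ereal" where
  "nested_objective P F s u x v = ereal (stage_cost P s x v) +
     (if s < stages P then F s u (\<lambda>u'. nested_value P F (Suc s) x u') else 0)"

definition cond_expectation ::
  "'w pmf \<Rightarrow> (nat \<Rightarrow> 'w \<Rightarrow> 'n demand) \<Rightarrow> 'n risk_measure" where
  "cond_expectation M \<xi> s u g =
     (\<Sum>u'\<in>\<xi> (Suc s) ` set_pmf M.
        ereal (\<P>(\<omega> in measure_pmf M. \<xi> (Suc s) \<omega> = u' \<bar> \<xi> s \<omega> = u)) * g u')"

text \<open>
  A node of the scenario tree at stage \<open>s\<close> is the list of realizations of stages \<open>1..s\<close>.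
  A policy assigns a state and a decision to every node.
\<close>

type_synonym 'n node = "'n demand list"

type_synonym 'n policy = "'n node \<Rightarrow> 'n state \<times> 'n decision"

definition node_at :: "(nat \<Rightarrow> 'w \<Rightarrow> 'n demand) \<Rightarrow> nat \<Rightarrow> 'w \<Rightarrow> 'n node" where
  "node_at \<xi> s \<omega> = map (\<lambda>r. \<xi> r \<omega>) [1..<Suc s]"

definition incoming :: "'n sav_model \<Rightarrow> 'n policy \<Rightarrow> 'n node \<Rightarrow> 'n state" where
  "incoming P \<pi> h = (if length h \<le> 1 then init_state P else fst (\<pi> (butlast h)))"

definition optimal_policy ::
  "'n::finite sav_model \<Rightarrow> 'w pmf \<Rightarrow> (nat \<Rightarrow> 'w \<Rightarrow> 'n demand) \<Rightarrow> 'n risk_measure \<Rightarrow> 'n policy \<Rightarrow> bool" where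
  "optimal_policy P M \<xi> F \<pi> \<longleftrightarrow>
     (\<forall>s\<in>{1..stages P}. \<forall>\<omega>\<in>set_pmf M.
        is_arg_min (\<lambda>(x, v). nested_objective P F s (\<xi> s \<omega>) x v)
          (\<lambda>(x, v). stage_feasible P s (incoming P \<pi> (node_at \<xi> s \<omega>)) (\<xi> s \<omega>) x v)
          (\<pi> (node_at \<xi> s \<omega>)))"

text \<open>
  Lagrangian dual of the capacity constraints in the risk-neutral linear program over the
  scenario tree. Taking expectations makes the multipliers normalized by the node probability.
\<close>

type_synonym 'n multiplier = "'n node \<Rightarrow> int \<Rightarrow> 'n \<times> 'n \<Rightarrow> real"

definition uncapacitated_policy ::
  "'n::finite sav_model \<Rightarrow> 'w pmf \<Rightarrow> (nat \<Rightarrow> 'w \<Rightarrow> 'n demand) \<Rightarrow> 'n policy \<Rightarrow> bool" where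
  "uncapacitated_policy P M \<xi> \<pi> \<longleftrightarrow>
     (\<forall>s\<in>{1..stages P}. \<forall>\<omega>\<in>set_pmf M.
        let h = node_at \<xi> s \<omega>
        in uncapacitated_feasible P s (incoming P \<pi> h) (\<xi> s \<omega>) (fst (\<pi> h)) (snd (\<pi> h)))"

definition lagrangian ::
  "'n::finite sav_model \<Rightarrow> 'w pmf \<Rightarrow> (nat \<Rightarrow> 'w \<Rightarrow> 'n demand) \<Rightarrow> 'n policy \<Rightarrow> 'n multiplier \<Rightarrow> real" where
  "lagrangian P M \<xi> \<pi> p =
     measure_pmf.expectation M (\<lambda>\<omega>. \<Sum>s\<in>{1..stages P}.
        let h = node_at \<xi> s \<omega> in stage_cost P s (fst (\<pi> h)) (snd (\<pi> h)))
     + measure_pmf.expectation M (\<lambda>\<omega>. \<Sum>s\<in>operational P. \<Sum>t\<in>steps P. \<Sum>ij\<in>arcs P.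
        let h = node_at \<xi> s \<omega>
        in p h t ij * (sav_flow (snd (\<pi> h)) t ij - cap (fst (\<pi> h)) ij))"

definition dual_function ::
  "'n::finite sav_model \<Rightarrow> 'w pmf \<Rightarrow> (nat \<Rightarrow> 'w \<Rightarrow> 'n demand) \<Rightarrow> 'n multiplier \<Rightarrow> ereal" where
  "dual_function P M \<xi> p =
     (INF \<pi>\<in>{\<pi>. uncapacitated_policy P M \<xi> \<pi>}. ereal (lagrangian P M \<xi> \<pi> p))"

definition dual_feasible ::
  "'n sav_model \<Rightarrow> 'w pmf \<Rightarrow> (nat \<Rightarrow> 'w \<Rightarrow> 'n demand) \<Rightarrow> 'n multiplier \<Rightarrow> bool" where
  "dual_feasible P M \<xi> p \<longleftrightarrow>
     (\<forall>s\<in>operational P. \<forall>\<omega>\<in>set_pmf M. \<forall>t\<in>steps P. \<forall>ij\<in>arcs P. 0 \<le> p (node_at \<xi> s \<omega>) t ij)"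

definition optimal_dual ::
  "'n::finite sav_model \<Rightarrow> 'w pmf \<Rightarrow> (nat \<Rightarrow> 'w \<Rightarrow> 'n demand) \<Rightarrow> 'n multiplier \<Rightarrow> bool" where
  "optimal_dual P M \<xi> p \<longleftrightarrow> is_arg_max (dual_function P M \<xi>) (dual_feasible P M \<xi>) p"

end

theory Submission
  imports Defs
begin

text \<open>
  Stagewise independence makes the scenario tree a product, so that a policy optimal in the nested
  (dynamic programming) sense minimizes the expected total cost among all feasible policies. Since
  the constraints are finitely many affine conditions on a policy, strong linear programming duality
  (from Farkas' lemma) shows that the optimal multipliers \<open>p\<close> satisfy complementary slackness and
  that the optimal policy minimizes the Lagrangian at \<open>p\<close> over the policies constrained by all but
  the capacity constraints. These remain satisfied when capacities and expansions of the arc \<open>ij\<close>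
  are scaled by any \<open>r \<ge> 0\<close>, because its initial capacity is zero. The Lagrangian is affine in
  \<open>r\<close> and minimal at \<open>r = 1\<close>, so its slope vanishes: infrastructure costs equal the expected value
  of \<open>p \<kappa>\<close>, which is that of \<open>p z\<close> by complementary slackness.
\<close>

subsection \<open>Farkas' lemma\<close>

text \<open>
  Policies do not form a type of class \<open>real_vector\<close>. Farkas' lemma needs only an operation \<open>c\<close>,
  \<open>c a x b y\<close> standing for \<open>a x + b y\<close>, that the functionals turn into linear combinations.
\<close>

definition linear_wrt :: "(real \<Rightarrow> 'x \<Rightarrow> real \<Rightarrow> 'x \<Rightarrow> 'x) \<Rightarrow> ('x \<Rightarrow> real) \<Rightarrow> bool" where
  "linear_wrt c f \<longleftrightarrow> (\<forall>a b x y. f (c a x b y) = a * f x + b * f y)"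

lemma linear_wrt_diff_scaled:
  assumes "linear_wrt c f" "linear_wrt c g"
  shows "linear_wrt c (\<lambda>x. f x - k * g x)"
  using assms by (simp add: linear_wrt_def algebra_simps)

text \<open>Induction on the constraints. If those in \<open>I\<close> alone already imply
  \<open>g x \<le> 0\<close>, the new one gets weight 0. Otherwise some \<open>x\<close> violates
  the conclusion while satisfying \<open>I\<close>, and projecting along \<open>x\<close> onto the
  kernel of \<open>f m\<close> eliminates the constraint \<open>m\<close>.\<close>

lemma farkas:
  assumes "finite I" "\<And>i. i \<in> I \<Longrightarrow> linear_wrt c (f i)" "linear_wrt c g"
    and "\<And>x. (\<And>i. i \<in> I \<Longrightarrow> f i x \<le> 0) \<Longrightarrow> g x \<le> 0"
  shows "\<exists>w. (\<forall>i\<in>I. 0 \<le> w i) \<and> (\<forall>x. g x = (\<Sum>i\<in>I. w i * f i x))"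
  using assms
proof (induction I arbitrary: f g rule: finite_induct)
  case empty
  have "g x = 0" for x
  proof -
    \<comment> \<open>Here \<open>c (-1) x 0 x\<close> stands for \<open>- x\<close>. Without
      constraints both \<open>g x\<close> and \<open>- g x\<close> are nonpositive.\<close>
    have "g (c (-1) x 0 x) = - g x"
      using empty.prems(2) by (simp add: linear_wrt_def)
    moreover have "g x \<le> 0" "g (c (-1) x 0 x) \<le> 0"
      using empty.prems(3) by blast+
    ultimately show ?thesis by simp
  qed
  then show ?case by simp
next
  case (insert m I)
  show ?case
  proof (cases "\<exists>x. (\<forall>i\<in>I. f i x \<le> 0) \<and> g x > 0")
    case False
    then obtain w where w: "\<forall>i\<in>I. 0 \<le> w i" "\<forall>x. g x = (\<Sum>i\<in>I. w i * f i x)"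
      using insert.IH[of f g] insert.prems by (metis insertCI linorder_not_le)
    have "(\<Sum>i\<in>insert m I. (w(m := 0)) i * f i x) = (\<Sum>i\<in>I. w i * f i x)" for x
      using insert.hyps by (auto intro!: sum.cong)
    then show ?thesis
      using w by (intro exI[of _ "w(m := 0)"]) auto
  next
    case True
    then obtain x where x: "\<forall>i\<in>I. f i x \<le> 0" "g x > 0" by blast
    have lin: "linear_wrt c (f m)" "linear_wrt c g" "\<And>i. i \<in> I \<Longrightarrow> linear_wrt c (f i)"
      using insert.prems by auto
    \<comment> \<open>Otherwise \<open>x\<close> would satisfy all constraints and
      \<open>g x\<close> could not be positive.\<close>
    have pos: "f m x > 0"
      using insert.prems(3)[of x] x by (metis insert_iff not_le)
    \<comment> \<open>The multiples of \<open>f m\<close> are chosen so that \<open>f' i\<close> and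
      \<open>g'\<close> vanish at \<open>x\<close>; they are thus invariant under moves along
      \<open>x\<close>.\<close>
    define f' where "f' i y = f i y - (f i x / f m x) * f m y" for i y
    define g' where "g' y = g y - (g x / f m x) * f m y" for y
    have lin': "linear_wrt c (f' i)" if "i \<in> I" for i
      unfolding f'_def using lin that by (intro linear_wrt_diff_scaled) auto
    have ling': "linear_wrt c g'"
      unfolding g'_def using lin by (intro linear_wrt_diff_scaled) auto
    have "g' y \<le> 0" if y: "\<And>i. i \<in> I \<Longrightarrow> f' i y \<le> 0" for y
    proof -
      \<comment> \<open>The point \<open>y\<close> is moved along \<open>x\<close> to the hyperplane
        \<open>f m = 0\<close>: constraint \<open>m\<close> holds there with equality, and
        \<open>f i z = f' i y\<close>, \<open>g z = g' y\<close>.\<close>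
      define z where "z = c 1 y (- (f m y / f m x)) x"
      have z: "h z = h y - (h x / f m x) * f m y" if "linear_wrt c h" for h
        using that by (simp add: z_def linear_wrt_def)
      have "f i z \<le> 0" if "i \<in> insert m I" for i
      proof (cases "i = m")
        case True
        then show ?thesis using z[OF lin(1)] pos by simp
      next
        case False
        then show ?thesis using that z[of "f i"] lin(3) y[of i] by (simp add: f'_def)
      qed
      then have "g z \<le> 0" by (rule insert.prems(3))
      then show ?thesis using z[OF lin(2)] by (simp add: g'_def)
    qed
    then obtain w where w: "\<forall>i\<in>I. 0 \<le> w i" "\<forall>y. g' y = (\<Sum>i\<in>I. w i * f' i y)"
      using insert.IH[of f' g'] lin' ling' by blast
    \<comment> \<open>This is the coefficient of \<open>f m\<close> left over when \<open>f'\<close>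
      and \<open>g'\<close> are expanded. It is nonnegative because at \<open>x\<close> the sum is
      nonpositive and \<open>g x > 0\<close>.\<close>
    define v where "v = (g x - (\<Sum>i\<in>I. w i * f i x)) / f m x"
    have "(\<Sum>i\<in>I. w i * f i x) \<le> 0"
      using w(1) x(1) by (intro sum_nonpos) (auto simp: mult_le_0_iff)
    then have "0 \<le> v" using x(2) pos by (simp add: v_def)
    have eq: "g y = v * f m y + (\<Sum>i\<in>I. w i * f i y)" for y
    proof -
      have "g y = (g x / f m x) * f m y + (\<Sum>i\<in>I. w i * f' i y)"
        using w(2) by (metis add.commute diff_add_cancel g'_def)
      also have "(\<Sum>i\<in>I. w i * f' i y)
          = (\<Sum>i\<in>I. w i * f i y) - (\<Sum>i\<in>I. w i * f i x) / f m x * f m y"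
        by (simp add: f'_def algebra_simps sum_subtractf sum_distrib_left sum_divide_distrib)
      finally show ?thesis by (simp add: v_def diff_divide_distrib algebra_simps)
    qed
    have "(\<Sum>i\<in>insert m I. (w(m := v)) i * f i y) = v * f m y + (\<Sum>i\<in>I. w i * f i y)" for y
      using insert.hyps by (auto intro!: sum.cong)
    then show ?thesis
      using w(1) \<open>0 \<le> v\<close> eq by (intro exI[of _ "w(m := v)"]) auto
  qed
qed

text \<open>The coefficients of \<open>c\<close> are arbitrary, not only those with sum 1, so
  \<open>k\<close> acts as the value at the origin.\<close>

definition affine_wrt :: "(real \<Rightarrow> 'x \<Rightarrow> real \<Rightarrow> 'x \<Rightarrow> 'x) \<Rightarrow> ('x \<Rightarrow> real) \<Rightarrow> bool" where
  "affine_wrt c f \<longleftrightarrow> (\<exists>k. linear_wrt c (\<lambda>x. f x - k))"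

text \<open>
  Homogenization: a pair \<open>(x, r)\<close> with \<open>r > 0\<close> stands for the point \<open>x / r\<close>, and \<open>(x, 0)\<close> for
  the direction \<open>x\<close>.
\<close>

lemma affine_farkas:
  assumes fin: "finite I" and aff: "\<And>i. i \<in> I \<Longrightarrow> affine_wrt c (f i)" "affine_wrt c g"
    and x0: "\<And>i. i \<in> I \<Longrightarrow> f i x\<^sub>0 \<le> 0"
    and imp: "\<And>x. (\<And>i. i \<in> I \<Longrightarrow> f i x \<le> 0) \<Longrightarrow> g x \<le> 0"
  shows "\<exists>w. (\<forall>i\<in>I. 0 \<le> w i) \<and> (\<forall>x. g x \<le> (\<Sum>i\<in>I. w i * f i x))"
proof -
  obtain k where k: "\<And>i. i \<in> I \<Longrightarrow> linear_wrt c (\<lambda>x. f i x - k i)"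
    using aff(1) unfolding affine_wrt_def by metis
  obtain l where l: "linear_wrt c (\<lambda>x. g x - l)"
    using aff(2) unfolding affine_wrt_def by metis
  define c' where "c' a xr b yr = (c a (fst xr) b (fst yr), a * snd xr + b * snd yr)"
    for a b :: real and xr yr
  \<comment> \<open>Index \<open>None\<close> encodes \<open>0 \<le> r\<close>. The other
    constraints become homogeneous by multiplying their constant \<open>k j\<close> by the extra
    coordinate.\<close>
  define F where "F i xr =
    (case i of None \<Rightarrow> - snd xr | Some j \<Rightarrow> f j (fst xr) - k j + k j * snd xr)" for i xr
  define G where "G xr = g (fst xr) - l + l * snd xr" for xr
  define J where "J = insert None (Some ` I)"
  have linF: "linear_wrt c' (F i)" if "i \<in> J" for i
  proof (cases i)
    case None
    then show ?thesis by (simp add: linear_wrt_def F_def c'_def)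
  next
    case (Some j)
    then have "j \<in> I" using that by (auto simp: J_def)
    from k[OF this] show ?thesis
      unfolding linear_wrt_def F_def c'_def Some by (simp add: algebra_simps)
  qed
  have linG: "linear_wrt c' G"
    using l unfolding linear_wrt_def G_def c'_def by (simp add: algebra_simps)
  have "G xr \<le> 0" if xr: "\<And>i. i \<in> J \<Longrightarrow> F i xr \<le> 0" for xr
  proof -
    obtain x r where [simp]: "xr = (x, r)" by (cases xr)
    have r: "0 \<le> r" using xr[of None] by (simp add: J_def F_def)
    have F: "f i x - k i + k i * r \<le> 0" if "i \<in> I" for i
      using xr[of "Some i"] that by (simp add: J_def F_def)
    show ?thesis
    proof (cases "r = 0")
      case False
      \<comment> \<open>This is the point \<open>x / r\<close>, at which the original hypothesis can
        be used.\<close>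
      define y where "y = c (1 / r) x 0 x"
      have y: "h y = (h x - m + m * r) / r" if "linear_wrt c (\<lambda>x. h x - m)" for h m
      proof -
        have "h y - m = (1 / r) * (h x - m) + 0 * (h x - m)"
          using that unfolding linear_wrt_def y_def by blast
        then show ?thesis using False by (simp add: field_simps)
      qed
      then have "f i y \<le> 0" if "i \<in> I" for i
        using y[OF k[OF that]] F[OF that] r by (simp add: divide_nonpos_nonneg)
      then have "g y \<le> 0" by (rule imp)
      then show ?thesis using y[OF l] r False by (simp add: G_def divide_le_0_iff)
    next
      case True
      \<comment> \<open>For \<open>r = 0\<close> the direction \<open>x\<close> is a recession
        direction: the whole ray from the feasible point \<open>x\<^sub>0\<close> stays feasible, so
        \<open>g\<close> is bounded above on it and its slope \<open>g x - l\<close> cannot be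
        positive.\<close>
      have *: "g x\<^sub>0 + t * (g x - l) \<le> 0" if t: "0 \<le> t" for t
      proof -
        have ray: "h (c 1 x\<^sub>0 t x) = h x\<^sub>0 + t * (h x - m)"
          if "linear_wrt c (\<lambda>x. h x - m)" for h m
        proof -
          have "h (c 1 x\<^sub>0 t x) - m = 1 * (h x\<^sub>0 - m) + t * (h x - m)"
            using that unfolding linear_wrt_def by blast
          then show ?thesis by simp
        qed
        have "t * (f i x - k i) \<le> 0" if "i \<in> I" for i
          using F[OF that] True t by (simp add: mult_nonneg_nonpos)
        then have "f i (c 1 x\<^sub>0 t x) \<le> 0" if "i \<in> I" for i
          using ray[OF k[OF that]] x0[OF that] that by (metis add_nonpos_nonpos)
        then have "g (c 1 x\<^sub>0 t x) \<le> 0" by (rule imp)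
        then show ?thesis using ray[OF l] by simp
      qed
      have "g x - l \<le> 0"
      proof (rule ccontr)
        assume "\<not> g x - l \<le> 0"
        then have pos: "0 < g x - l" by simp
        \<comment> \<open>At this parameter the left-hand side is
          \<open>g x\<^sub>0 + \<bar>g x\<^sub>0\<bar> + 1\<close>, which is at least 1.\<close>
        from *[of "(\<bar>g x\<^sub>0\<bar> + 1) / (g x - l)"] pos show False by simp
      qed
      then show ?thesis by (simp add: G_def True)
    qed
  qed
  moreover have "finite J" using fin by (simp add: J_def)
  ultimately obtain w where w: "\<forall>i\<in>J. 0 \<le> w i" "\<forall>xr. G xr = (\<Sum>i\<in>J. w i * F i xr)"
    using farkas[of J c' F G] linF linG by blast
  have "g x \<le> (\<Sum>i\<in>I. w (Some i) * f i x)" for x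
  proof -
    \<comment> \<open>Dehomogenization at \<open>r = 1\<close>. The term of \<open>None\<close>
      becomes the constant \<open>- w None \<le> 0\<close>; dropping it turns the equation into an
      inequality.\<close>
    have "g x = G (x, 1)" by (simp add: G_def)
    also have "\<dots> = (\<Sum>i\<in>J. w i * F i (x, 1))" using w(2) by blast
    also have "\<dots> = - w None + (\<Sum>i\<in>I. w (Some i) * f i x)"
      unfolding J_def using fin by (subst sum.insert) (auto simp: F_def sum.reindex)
    finally show ?thesis using w(1) by (simp add: J_def)
  qed
  then show ?thesis using w(1) by (intro exI[of _ "w \<circ> Some"]) (auto simp: J_def)
qed

subsection \<open>Lagrange multipliers over polyhedral sets\<close>

definition polyhedral_wrt :: "(real \<Rightarrow> 'x \<Rightarrow> real \<Rightarrow> 'x \<Rightarrow> 'x) \<Rightarrow> ('x \<Rightarrow> bool) \<Rightarrow> bool" where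
  "polyhedral_wrt c Q \<longleftrightarrow>
     (\<exists>H. finite H \<and> (\<forall>h\<in>H. affine_wrt c h) \<and> (\<forall>x. Q x \<longleftrightarrow> (\<forall>h\<in>H. h x \<le> 0)))"

text \<open>Affine Farkas for the inequalities of \<open>U\<close> together with those of
  \<open>K\<close>, the conclusion being \<open>v - g x \<le> 0\<close>. On \<open>U\<close> the
  terms of its own inequalities are nonpositive, so only the multipliers of \<open>K\<close> remain.
  The disjoint sum keeps both families apart.\<close>

lemma lagrange_multipliers_exist:
  assumes U: "polyhedral_wrt c U" and K: "finite K" "\<And>k. k \<in> K \<Longrightarrow> affine_wrt c (f k)"
    and g: "affine_wrt c g"
    and x0: "U x\<^sub>0" "\<And>k. k \<in> K \<Longrightarrow> f k x\<^sub>0 \<le> 0"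
    and min: "\<And>x. U x \<Longrightarrow> (\<And>k. k \<in> K \<Longrightarrow> f k x \<le> 0) \<Longrightarrow> v \<le> g x"
  shows "\<exists>w. (\<forall>k\<in>K. 0 \<le> w k) \<and> (\<forall>x. U x \<longrightarrow> v \<le> g x + (\<Sum>k\<in>K. w k * f k x))"
proof -
  obtain H where H: "finite H" "\<forall>h\<in>H. affine_wrt c h" "\<forall>x. U x \<longleftrightarrow> (\<forall>h\<in>H. h x \<le> 0)"
    using U unfolding polyhedral_wrt_def by blast
  obtain a where a: "linear_wrt c (\<lambda>x. g x - a)"
    using g unfolding affine_wrt_def by blast
  have "affine_wrt c (\<lambda>x. v - g x)"
    unfolding affine_wrt_def
    using a by (intro exI[of _ "v - a"]) (simp add: linear_wrt_def algebra_simps)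
  moreover have "finite (H <+> K)" using H(1) K(1) by simp
  moreover have "affine_wrt c (case_sum id f i)" if "i \<in> H <+> K" for i
    using that H(2) K(2) by auto
  moreover have "case_sum id f i x\<^sub>0 \<le> 0" if "i \<in> H <+> K" for i
    using that H(3) x0 by auto
  moreover have "v - g x \<le> 0" if "\<And>i. i \<in> H <+> K \<Longrightarrow> case_sum id f i x \<le> 0" for x
  proof -
    have "h x \<le> 0" if "h \<in> H" for h
      using that \<open>\<And>i. i \<in> H <+> K \<Longrightarrow> case_sum id f i x \<le> 0\<close>[of "Inl h"] by auto
    then have "U x" using H(3) by blast
    moreover have "f k x \<le> 0" if "k \<in> K" for k
      using that \<open>\<And>i. i \<in> H <+> K \<Longrightarrow> case_sum id f i x \<le> 0\<close>[of "Inr k"] by auto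
    ultimately show ?thesis using min by simp
  qed
  ultimately obtain w where w: "\<forall>i\<in>H <+> K. 0 \<le> w i"
      "\<forall>x. v - g x \<le> (\<Sum>i\<in>H <+> K. w i * case_sum id f i x)"
    using affine_farkas[of "H <+> K" c "case_sum id f" "\<lambda>x. v - g x" x\<^sub>0] by blast
  have "v \<le> g x + (\<Sum>k\<in>K. w (Inr k) * f k x)" if "U x" for x
  proof -
    have "(\<Sum>h\<in>H. w (Inl h) * h x) \<le> 0"
      using w(1) H(3) that by (intro sum_nonpos) (auto simp: mult_le_0_iff)
    then show ?thesis
      using w(2)[rule_format, of x] H(1) K(1) by (simp add: sum.Plus)
  qed
  then show ?thesis using w(1) by (intro exI[of _ "w \<circ> Inr"]) auto
qed

section \<open>Closure properties of affine functionals and polyhedral predicates\<close>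

lemma affine_wrt_const: "affine_wrt c (\<lambda>_. k)"
  by (auto simp: affine_wrt_def linear_wrt_def intro!: exI[of _ k])

lemma affine_wrt_add:
  assumes "affine_wrt c f" "affine_wrt c g"
  shows "affine_wrt c (\<lambda>x. f x + g x)"
proof -
  obtain k l where "linear_wrt c (\<lambda>x. f x - k)" "linear_wrt c (\<lambda>x. g x - l)"
    using assms unfolding affine_wrt_def by blast
  then have "linear_wrt c (\<lambda>x. f x + g x - (k + l))"
    unfolding linear_wrt_def by (simp add: algebra_simps) (smt (verit))
  then show ?thesis unfolding affine_wrt_def by blast
qed

lemma affine_wrt_cmult:
  assumes "affine_wrt c f"
  shows "affine_wrt c (\<lambda>x. a * f x)"
proof -
  obtain k where "linear_wrt c (\<lambda>x. f x - k)"
    using assms unfolding affine_wrt_def by blast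
  then have "linear_wrt c (\<lambda>x. a * (f x - k))"
    unfolding linear_wrt_def by (metis distrib_left mult.left_commute)
  then have "linear_wrt c (\<lambda>x. a * f x - a * k)"
    by (simp add: right_diff_distrib)
  then show ?thesis unfolding affine_wrt_def by blast
qed

lemma affine_wrt_diff:
  assumes "affine_wrt c f" "affine_wrt c g"
  shows "affine_wrt c (\<lambda>x. f x - g x)"
  using affine_wrt_add[OF assms(1) affine_wrt_cmult[OF assms(2), of "-1"]] by simp

lemma affine_wrt_sum:
  assumes "\<And>i. i \<in> A \<Longrightarrow> affine_wrt c (f i)"
  shows "affine_wrt c (\<lambda>x. \<Sum>i\<in>A. f i x)"
  using assms
  by (induction A rule: infinite_finite_induct) (auto intro: affine_wrt_const affine_wrt_add)

lemma affine_wrt_if: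
  assumes "b \<Longrightarrow> affine_wrt c f" "\<not> b \<Longrightarrow> affine_wrt c g"
  shows "affine_wrt c (\<lambda>x. if b then f x else g x)"
  using assms by (cases b) auto

lemmas affine_wrt_intros =
  affine_wrt_const affine_wrt_add affine_wrt_diff affine_wrt_cmult affine_wrt_sum affine_wrt_if

lemma polyhedral_wrt_le:
  assumes "affine_wrt c f" "affine_wrt c g"
  shows "polyhedral_wrt c (\<lambda>x. f x \<le> g x)"
  unfolding polyhedral_wrt_def
  using affine_wrt_diff[OF assms] by (intro exI[of _ "{\<lambda>x. f x - g x}"]) auto

lemma polyhedral_wrt_True: "polyhedral_wrt c (\<lambda>_. True)"
  unfolding polyhedral_wrt_def by (intro exI[of _ "{}"]) auto

lemma polyhedral_wrt_conj:
  assumes "polyhedral_wrt c Q" "polyhedral_wrt c R"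
  shows "polyhedral_wrt c (\<lambda>x. Q x \<and> R x)"
proof -
  obtain G H where "finite G" "\<forall>h\<in>G. affine_wrt c h" "\<forall>x. Q x \<longleftrightarrow> (\<forall>h\<in>G. h x \<le> 0)"
    "finite H" "\<forall>h\<in>H. affine_wrt c h" "\<forall>x. R x \<longleftrightarrow> (\<forall>h\<in>H. h x \<le> 0)"
    using assms unfolding polyhedral_wrt_def by blast
  then show ?thesis
    unfolding polyhedral_wrt_def by (intro exI[of _ "G \<union> H"]) auto
qed

lemma polyhedral_wrt_eq:
  assumes "affine_wrt c f" "affine_wrt c g"
  shows "polyhedral_wrt c (\<lambda>x. f x = g x)"
  using polyhedral_wrt_conj[OF polyhedral_wrt_le[OF assms] polyhedral_wrt_le[OF assms(2,1)]]
  by (simp add: order_eq_iff)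

lemma polyhedral_wrt_ball:
  assumes "finite A" "\<And>a. a \<in> A \<Longrightarrow> polyhedral_wrt c (Q a)"
  shows "polyhedral_wrt c (\<lambda>x. \<forall>a\<in>A. Q a x)"
  using assms
  by (induction A rule: finite_induct) (auto intro: polyhedral_wrt_True polyhedral_wrt_conj)

lemma polyhedral_wrt_all:
  assumes "\<And>a::'a::finite. polyhedral_wrt c (Q a)"
  shows "polyhedral_wrt c (\<lambda>x. \<forall>a. Q a x)"
  using polyhedral_wrt_ball[of UNIV c Q] assms by simp

lemma polyhedral_wrt_if:
  assumes "b \<Longrightarrow> polyhedral_wrt c Q" "\<not> b \<Longrightarrow> polyhedral_wrt c R"
  shows "polyhedral_wrt c (\<lambda>x. if b then Q x else R x)"
  using assms by (cases b) auto

lemmas polyhedral_wrt_intros =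
  polyhedral_wrt_le polyhedral_wrt_eq polyhedral_wrt_conj polyhedral_wrt_ball polyhedral_wrt_all
  polyhedral_wrt_if

lemma sum_nonpos_eq_0D:
  fixes f :: "'a \<Rightarrow> real"
  assumes "finite A" "sum f A = 0" "a \<in> A" "\<And>a. a \<in> A \<Longrightarrow> f a \<le> 0"
  shows "f a = 0"
  using sum_nonneg_eq_0_iff[of A "\<lambda>a. - f a"] assms by (simp add: sum_negf)

lemma sum_change_one:
  fixes f :: "'a \<Rightarrow> real"
  assumes "finite A" "a \<in> A" "\<And>b. b \<in> A \<Longrightarrow> b \<noteq> a \<Longrightarrow> g b = f b"
  shows "sum g A = sum f A + (g a - f a)"
proof -
  have "sum g (A - {a}) = sum f (A - {a})" using assms(3) by (intro sum.cong) auto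
  then show ?thesis using assms(1,2) by (simp add: sum.remove)
qed

subsection \<open>The scenario tree\<close>

lemma node_at_0 [simp]: "node_at \<xi> 0 \<omega> = []"
  by (simp add: node_at_def)

lemma node_at_Suc [simp]: "node_at \<xi> (Suc s) \<omega> = node_at \<xi> s \<omega> @ [\<xi> (Suc s) \<omega>]"
  by (simp add: node_at_def)

lemma length_node_at [simp]: "length (node_at \<xi> s \<omega>) = s"
  by (simp add: node_at_def)

lemma node_at_eq_iff:
  assumes "length h = s"
  shows "node_at \<xi> s \<omega> = h \<longleftrightarrow> (\<forall>r\<in>{1..s}. \<xi> r \<omega> = h ! (r - 1))"
proof
  assume "node_at \<xi> s \<omega> = h"
  then show "\<forall>r\<in>{1..s}. \<xi> r \<omega> = h ! (r - 1)"
    by (auto simp: node_at_def simp del: upt_Suc)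
next
  assume *: "\<forall>r\<in>{1..s}. \<xi> r \<omega> = h ! (r - 1)"
  show "node_at \<xi> s \<omega> = h"
  proof (rule nth_equalityI)
    fix i assume "i < length (node_at \<xi> s \<omega>)"
    then have "i < s" by simp
    then show "node_at \<xi> s \<omega> ! i = h ! i"
      using *[rule_format, of "Suc i"] by (simp add: node_at_def del: upt_Suc)
  qed (simp add: assms)
qed

locale sav_tree =
  fixes P :: "'n::finite sav_model"
    and M :: "'w pmf"
    and \<xi> :: "nat \<Rightarrow> 'w \<Rightarrow> 'n demand"
  assumes finite_realizations: "s \<in> {1..stages P} \<Longrightarrow> finite (\<xi> s ` set_pmf M)"
    and stagewise_independent:
      "prob_space.indep_vars (measure_pmf M) (\<lambda>_. count_space UNIV) \<xi> {1..stages P}"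
begin

section \<open>Product form of the node distributions under stagewise independence\<close>

abbreviation realization :: "nat \<Rightarrow> 'n demand pmf" where
  "realization s \<equiv> map_pmf (\<xi> s) M"

abbreviation node :: "nat \<Rightarrow> 'n node pmf" where
  "node s \<equiv> map_pmf (node_at \<xi> s) M"

text \<open>Independence applied to singletons. It serves both for the stages leading to a node and
  for a pair of consecutive stages.\<close>

lemma prob_joint:
  assumes "J \<subseteq> {1..stages P}" "J \<noteq> {}"
  shows "measure (measure_pmf M) {\<omega>. \<forall>r\<in>J. \<xi> r \<omega> = v r} = (\<Prod>r\<in>J. pmf (realization r) (v r))"
proof -
  have "finite J" using assms(1) finite_subset by blast
  have "measure (measure_pmf M) (\<Inter>r\<in>J. \<xi> r -` {v r} \<inter> space (measure_pmf M)) =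
      (\<Prod>r\<in>J. measure (measure_pmf M) (\<xi> r -` {v r} \<inter> space (measure_pmf M)))"
    using assms \<open>finite J\<close>
    by (intro prob_space.indep_varsD[OF measure_pmf.prob_space_axioms stagewise_independent]) auto
  moreover have "(\<Inter>r\<in>J. \<xi> r -` {v r} \<inter> space (measure_pmf M)) = {\<omega>. \<forall>r\<in>J. \<xi> r \<omega> = v r}"
    using assms(2) by auto
  ultimately show ?thesis by (simp add: pmf_map)
qed

lemma pmf_node:
  assumes "length h = s" "s \<le> stages P"
  shows "pmf (node s) h = (\<Prod>r=1..s. pmf (realization r) (h ! (r - 1)))"
proof (cases "s = 0")
  case True
  then have "node_at \<xi> s -` {h} = UNIV" using assms(1) by auto
  then show ?thesis using True by (simp add: pmf_map)
next
  case False
  have "node_at \<xi> s -` {h} = {\<omega>. \<forall>r\<in>{1..s}. \<xi> r \<omega> = h ! (r - 1)}"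
    by (simp add: vimage_def node_at_eq_iff[OF assms(1)])
  then show ?thesis
    using prob_joint[of "{1..s}" "\<lambda>r. h ! (r - 1)"] False assms(2) by (simp add: pmf_map)
qed

lemma length_node: "h \<in> set_pmf (node s) \<Longrightarrow> length h = s"
  by auto

lemma pmf_node_Suc:
  assumes "length h = s" "s < stages P"
  shows "pmf (node (Suc s)) (h @ [u]) = pmf (node s) h * pmf (realization (Suc s)) u"
proof -
  have "pmf (node (Suc s)) (h @ [u]) =
      (\<Prod>r=1..s. pmf (realization r) ((h @ [u]) ! (r - 1))) * pmf (realization (Suc s)) u"
    using pmf_node[of "h @ [u]" "Suc s"] assms by (simp add: nth_append)
  also have "(\<Prod>r=1..s. pmf (realization r) ((h @ [u]) ! (r - 1))) = pmf (node s) h"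
    using pmf_node[of h s] assms by (auto simp: nth_append intro!: prod.cong)
  finally show ?thesis .
qed

text \<open>By independence every realization of the next stage can follow every node: the
  probability of the extended node is a product of two positive numbers.\<close>

lemma set_node_Suc:
  assumes "s < stages P"
  shows "set_pmf (node (Suc s)) =
    (\<lambda>(h, u). h @ [u]) ` (set_pmf (node s) \<times> set_pmf (realization (Suc s)))"
proof (intro equalityI subsetI)
  fix k assume "k \<in> set_pmf (node (Suc s))"
  then show "k \<in> (\<lambda>(h, u). h @ [u]) ` (set_pmf (node s) \<times> set_pmf (realization (Suc s)))"
    by auto
next
  fix k assume "k \<in> (\<lambda>(h, u). h @ [u]) ` (set_pmf (node s) \<times> set_pmf (realization (Suc s)))"
  then obtain h u where k: "k = h @ [u]"
    and hu: "h \<in> set_pmf (node s)" "u \<in> set_pmf (realization (Suc s))" by auto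
  have "0 < pmf (node s) h * pmf (realization (Suc s)) u"
    using hu by (simp only: mult_pos_pos pmf_positive)
  then have "0 < pmf (node (Suc s)) k"
    using pmf_node_Suc[OF length_node[OF hu(1)] assms] k by simp
  then show "k \<in> set_pmf (node (Suc s))" by (simp add: set_pmf_iff del: set_map_pmf)
qed

lemma finite_realization: "s \<in> {1..stages P} \<Longrightarrow> finite (set_pmf (realization s))"
  using finite_realizations by simp

lemma finite_node: "s \<le> stages P \<Longrightarrow> finite (set_pmf (node s))"
proof (induction s)
  case 0
  have "set_pmf (node 0) \<subseteq> {[]}" by auto
  then show ?case using finite_subset by blast
next
  case (Suc s)
  then have "s < stages P" by simp
  show ?case
    unfolding set_node_Suc[OF \<open>s < stages P\<close>]
    using Suc finite_realization[of "Suc s"]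
    by (intro finite_imageI finite_cartesian_product) auto
qed

text \<open>The tower rule: averaging over stage \<open>Suc s\<close> is averaging over stage
  \<open>s\<close> of the average over the children.\<close>

lemma sum_node_Suc:
  fixes f :: "'n node \<Rightarrow> real"
  assumes "s < stages P"
  shows "(\<Sum>k\<in>set_pmf (node (Suc s)). pmf (node (Suc s)) k * f k) =
    (\<Sum>h\<in>set_pmf (node s). pmf (node s) h *
      (\<Sum>u\<in>set_pmf (realization (Suc s)). pmf (realization (Suc s)) u * f (h @ [u])))"
proof -
  let ?A = "set_pmf (node s)" and ?B = "set_pmf (realization (Suc s))"
  have "(\<Sum>k\<in>set_pmf (node (Suc s)). pmf (node (Suc s)) k * f k) =
      (\<Sum>(h, u)\<in>?A \<times> ?B. pmf (node (Suc s)) (h @ [u]) * f (h @ [u]))"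
    unfolding set_node_Suc[OF assms]
    by (subst sum.reindex) (auto simp: inj_on_def case_prod_beta)
  also have "\<dots> = (\<Sum>h\<in>?A. \<Sum>u\<in>?B. pmf (node (Suc s)) (h @ [u]) * f (h @ [u]))"
    by (rule sum.cartesian_product[symmetric])
  also have "\<dots> = (\<Sum>h\<in>?A. \<Sum>u\<in>?B. pmf (node s) h * (pmf (realization (Suc s)) u * f (h @ [u])))"
    using pmf_node_Suc[OF length_node assms] by (intro sum.cong refl) simp
  finally show ?thesis by (simp only: sum_distrib_left)
qed

text \<open>The expectation over the tree as a finite sum, weighted by unconditional node
  probabilities.\<close>

definition expected_sum :: "nat set \<Rightarrow> (nat \<Rightarrow> 'n node \<Rightarrow> real) \<Rightarrow> real" where
  "expected_sum A f = (\<Sum>s\<in>A. \<Sum>h\<in>set_pmf (node s). pmf (node s) h * f s h)"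

lemma expectation_eq_expected_sum:
  assumes "A \<subseteq> {1..stages P}"
  shows "measure_pmf.expectation M (\<lambda>\<omega>. \<Sum>s\<in>A. f s (node_at \<xi> s \<omega>)) = expected_sum A f"
proof -
  have fin: "finite (set_pmf (node s))" if "s \<in> A" for s
    using that assms finite_node[of s] by (meson atLeastAtMost_iff subsetD)
  have "integrable (measure_pmf M) (\<lambda>\<omega>. f s (node_at \<xi> s \<omega>))" if "s \<in> A" for s
    using integrable_measure_pmf_finite[OF fin[OF that], of "f s"] by simp
  then have "measure_pmf.expectation M (\<lambda>\<omega>. \<Sum>s\<in>A. f s (node_at \<xi> s \<omega>)) =
      (\<Sum>s\<in>A. measure_pmf.expectation M (\<lambda>\<omega>. f s (node_at \<xi> s \<omega>)))"
    by (rule Bochner_Integration.integral_sum)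
  also have "\<dots> = (\<Sum>s\<in>A. measure_pmf.expectation (node s) (f s))"
    by simp
  also have "\<dots> = expected_sum A f"
    unfolding expected_sum_def
    by (intro sum.cong refl) (simp add: integral_measure_pmf_real[OF fin] mult.commute del: set_map_pmf integral_map_pmf)
  finally show ?thesis .
qed

text \<open>Independence turns the conditional probabilities into marginal ones. The condition on
  \<open>u\<close> ensures that the event conditioned on has positive probability.\<close>

lemma cond_expectation_eq:
  assumes "1 \<le> s" "s < stages P" "u \<in> set_pmf (realization s)"
  shows "cond_expectation M \<xi> s u g =
    (\<Sum>u'\<in>set_pmf (realization (Suc s)). ereal (pmf (realization (Suc s)) u') * g u')"
proof -
  have "\<P>(\<omega> in measure_pmf M. \<xi> (Suc s) \<omega> = u' \<bar> \<xi> s \<omega> = u) = pmf (realization (Suc s)) u'"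
    for u'
  proof -
    have "measure (measure_pmf M) {\<omega>. \<xi> (Suc s) \<omega> = u' \<and> \<xi> s \<omega> = u} =
        pmf (realization s) u * pmf (realization (Suc s)) u'"
      using prob_joint[of "{s, Suc s}" "\<lambda>r. if r = s then u else u'"] assms(1,2)
      by (simp add: conj_commute)
    moreover have "measure (measure_pmf M) {\<omega>. \<xi> s \<omega> = u} = pmf (realization s) u"
      by (simp add: pmf_map vimage_def)
    moreover have "pmf (realization s) u \<noteq> 0"
      using assms(3) by (simp only: set_pmf_iff not_False_eq_True)
    ultimately show ?thesis
      by (simp add: cond_prob_def)
  qed
  then show ?thesis by (simp add: cond_expectation_def)
qed

subsection \<open>Dynamic programming\<close>

definition node_cost :: "'n policy \<Rightarrow> nat \<Rightarrow> 'n node \<Rightarrow> real" where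
  "node_cost \<pi> s h = stage_cost P s (fst (\<pi> h)) (snd (\<pi> h))"

definition feasible_policy :: "'n policy \<Rightarrow> bool" where
  "feasible_policy \<pi> \<longleftrightarrow> (\<forall>s\<in>{1..stages P}. \<forall>h\<in>set_pmf (node s).
     stage_feasible P s (incoming P \<pi> h) (last h) (fst (\<pi> h)) (snd (\<pi> h)))"

text \<open>The argument \<open>k\<close> counts the stages after that of \<open>h\<close>, so that
  the recursion, which lengthens \<open>h\<close>, is primitive.\<close>

primrec cost_to_go :: "'n policy \<Rightarrow> nat \<Rightarrow> 'n node \<Rightarrow> real" where
  "cost_to_go \<pi> 0 h = node_cost \<pi> (length h) h"
| "cost_to_go \<pi> (Suc k) h = node_cost \<pi> (length h) h +
     (\<Sum>u\<in>set_pmf (realization (Suc (length h))).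
        pmf (realization (Suc (length h))) u * cost_to_go \<pi> k (h @ [u]))"

text \<open>Unfolding the recursion and applying the tower rule at each stage collects the costs of
  all later nodes.\<close>

lemma expected_cost_to_go:
  assumes "1 \<le> s" "s + k = stages P"
  shows "(\<Sum>h\<in>set_pmf (node s). pmf (node s) h * cost_to_go \<pi> k h) =
    expected_sum {s..stages P} (node_cost \<pi>)"
  using assms
proof (induction k arbitrary: s)
  case 0
  then show ?case
    using length_node by (auto simp: expected_sum_def simp del: set_map_pmf intro!: sum.cong)
next
  case (Suc k)
  have "{s..stages P} = insert s {Suc s..stages P}" using Suc.prems by auto
  then have "expected_sum {s..stages P} (node_cost \<pi>) =
      (\<Sum>h\<in>set_pmf (node s). pmf (node s) h * node_cost \<pi> s h)
      + expected_sum {Suc s..stages P} (node_cost \<pi>)"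
    by (simp add: expected_sum_def)
  also have "expected_sum {Suc s..stages P} (node_cost \<pi>) =
      (\<Sum>h\<in>set_pmf (node (Suc s)). pmf (node (Suc s)) h * cost_to_go \<pi> k h)"
    using Suc.prems by (intro Suc.IH[symmetric]) simp_all
  also have "\<dots> = (\<Sum>h\<in>set_pmf (node s). pmf (node s) h *
      (\<Sum>u\<in>set_pmf (realization (Suc s)). pmf (realization (Suc s)) u * cost_to_go \<pi> k (h @ [u])))"
    using Suc.prems by (intro sum_node_Suc) simp
  also have "(\<Sum>h\<in>set_pmf (node s). pmf (node s) h * node_cost \<pi> s h) + \<dots> =
      (\<Sum>h\<in>set_pmf (node s). pmf (node s) h * cost_to_go \<pi> (Suc k) h)"
    unfolding sum.distrib[symmetric] distrib_left[symmetric]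
    using length_node by (intro sum.cong refl) (simp del: set_map_pmf)
  finally show ?case by simp
qed

lemma last_node: "1 \<le> s \<Longrightarrow> h \<in> set_pmf (node s) \<Longrightarrow> last h \<in> set_pmf (realization s)"
  by (cases s) auto

lemma snoc_node:
  assumes "s < stages P" "h \<in> set_pmf (node s)" "u \<in> set_pmf (realization (Suc s))"
  shows "h @ [u] \<in> set_pmf (node (Suc s))"
  using assms(2,3) unfolding set_node_Suc[OF assms(1)] by (force simp del: set_map_pmf)

lemma incoming_snoc: "h \<noteq> [] \<Longrightarrow> incoming P \<pi> (h @ [u]) = fst (\<pi> h)"
  by (cases h) (simp_all add: incoming_def)

text \<open>Backward induction: the choice of the policy at \<open>h\<close> is one candidate of the
  infimum, and the conditional expectation is monotone in the values at the children.\<close>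

lemma nested_value_le_cost_to_go:
  assumes "feasible_policy \<pi>" "1 \<le> s" "s + k = stages P" "h \<in> set_pmf (node s)"
  shows "nested_value P (cond_expectation M \<xi>) s (incoming P \<pi> h) (last h)
    \<le> ereal (cost_to_go \<pi> k h)"
  using assms(2-)
proof (induction k arbitrary: s h)
  case 0
  have feas: "stage_feasible P s (incoming P \<pi> h) (last h) (fst (\<pi> h)) (snd (\<pi> h))"
    using assms(1) 0 by (simp add: feasible_policy_def del: set_map_pmf)
  show ?case
    unfolding nested_value.simps[of P _ s]
    using feas 0 length_node[OF 0(3)]
    by (intro INF_lower2[of "\<pi> h"]) (auto simp: node_cost_def)
next
  case (Suc k)
  let ?F = "cond_expectation M \<xi>"
  let ?R = "realization (Suc s)"
  have s: "s < stages P" using Suc.prems by simp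
  have len: "length h = s" by (rule length_node[OF Suc.prems(3)])
  have feas: "stage_feasible P s (incoming P \<pi> h) (last h) (fst (\<pi> h)) (snd (\<pi> h))"
    using assms(1) Suc.prems by (simp add: feasible_policy_def del: set_map_pmf)
  have "?F s (last h) (\<lambda>u'. nested_value P ?F (Suc s) (fst (\<pi> h)) u')
      = (\<Sum>u\<in>set_pmf ?R. ereal (pmf ?R u) * nested_value P ?F (Suc s) (fst (\<pi> h)) u)"
    using last_node Suc.prems s by (intro cond_expectation_eq) auto
  also have "\<dots> \<le> (\<Sum>u\<in>set_pmf ?R. ereal (pmf ?R u) * ereal (cost_to_go \<pi> k (h @ [u])))"
  proof (intro sum_mono ereal_mult_left_mono)
    fix u assume "u \<in> set_pmf ?R"
    then have "h @ [u] \<in> set_pmf (node (Suc s))" using snoc_node s Suc.prems(3) by blast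
    from Suc.IH[OF _ _ this] Suc.prems len
    show "nested_value P ?F (Suc s) (fst (\<pi> h)) u \<le> ereal (cost_to_go \<pi> k (h @ [u]))"
      by (cases "h = []") (auto simp: incoming_snoc)
  qed simp
  finally have le: "?F s (last h) (\<lambda>u'. nested_value P ?F (Suc s) (fst (\<pi> h)) u')
      \<le> ereal (\<Sum>u\<in>set_pmf ?R. pmf ?R u * cost_to_go \<pi> k (h @ [u]))"
    by simp
  have "nested_value P ?F s (incoming P \<pi> h) (last h)
      \<le> ereal (stage_cost P s (fst (\<pi> h)) (snd (\<pi> h)))
        + ?F s (last h) (\<lambda>u'. nested_value P ?F (Suc s) (fst (\<pi> h)) u')"
    unfolding nested_value.simps[of P _ s]
    using feas s by (intro INF_lower2[of "\<pi> h"]) auto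
  also have "\<dots> \<le> ereal (stage_cost P s (fst (\<pi> h)) (snd (\<pi> h)))
      + ereal (\<Sum>u\<in>set_pmf ?R. pmf ?R u * cost_to_go \<pi> k (h @ [u]))"
    using le by (rule add_left_mono)
  finally show ?case using len by (simp add: node_cost_def del: set_map_pmf)
qed

text \<open>Optimality restated per node: the policy attains the infimum in the Bellman
  recursion.\<close>

lemma optimal_policy_node:
  assumes "optimal_policy P M \<xi> F \<pi>" "s \<in> {1..stages P}" "h \<in> set_pmf (node s)"
  shows "stage_feasible P s (incoming P \<pi> h) (last h) (fst (\<pi> h)) (snd (\<pi> h))"
    and "nested_value P F s (incoming P \<pi> h) (last h)
      = nested_objective P F s (last h) (fst (\<pi> h)) (snd (\<pi> h))"
proof -
  obtain \<omega> where \<omega>: "\<omega> \<in> set_pmf M" "h = node_at \<xi> s \<omega>" using assms(3) by auto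
  have "last h = \<xi> s \<omega>" using \<omega>(2) assms(2) by (cases s) auto
  then have min: "is_arg_min (\<lambda>(x, v). nested_objective P F s (last h) x v)
      (\<lambda>(x, v). stage_feasible P s (incoming P \<pi> h) (last h) x v) (\<pi> h)"
    using assms(1,2) \<omega> by (simp add: optimal_policy_def)
  then show feas: "stage_feasible P s (incoming P \<pi> h) (last h) (fst (\<pi> h)) (snd (\<pi> h))"
    by (simp add: is_arg_min_def case_prod_beta)
  have "nested_objective P F s (last h) (fst (\<pi> h)) (snd (\<pi> h))
      \<le> nested_objective P F s (last h) x v"
    if "stage_feasible P s (incoming P \<pi> h) (last h) x v" for x v
    using min that by (force simp: is_arg_min_def case_prod_beta not_less)
  then show "nested_value P F s (incoming P \<pi> h) (last h)
      = nested_objective P F s (last h) (fst (\<pi> h)) (snd (\<pi> h))"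
    unfolding nested_value.simps[of P F s] nested_objective_def
    using feas by (intro antisym INF_lower2[of "\<pi> h"] INF_greatest) auto
qed

lemma optimal_policy_feasible: "optimal_policy P M \<xi> F \<pi> \<Longrightarrow> feasible_policy \<pi>"
  unfolding feasible_policy_def using optimal_policy_node(1) by blast

text \<open>The same backward induction, now with equality since the infimum is attained. In
  particular the nested values along the tree are finite.\<close>

lemma nested_value_eq_cost_to_go:
  assumes "optimal_policy P M \<xi> (cond_expectation M \<xi>) \<pi>"
    "1 \<le> s" "s + k = stages P" "h \<in> set_pmf (node s)"
  shows "nested_value P (cond_expectation M \<xi>) s (incoming P \<pi> h) (last h)
    = ereal (cost_to_go \<pi> k h)"
  using assms(2-)
proof (induction k arbitrary: s h)
  case 0
  then have "nested_value P (cond_expectation M \<xi>) s (incoming P \<pi> h) (last h)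
      = nested_objective P (cond_expectation M \<xi>) s (last h) (fst (\<pi> h)) (snd (\<pi> h))"
    by (intro optimal_policy_node[OF assms(1)]) auto
  then show ?case
    using 0 length_node[OF 0(3)] by (simp add: nested_objective_def node_cost_def)
next
  case (Suc k)
  let ?F = "cond_expectation M \<xi>"
  let ?R = "realization (Suc s)"
  have s: "s < stages P" using Suc.prems by simp
  have len: "length h = s" by (rule length_node[OF Suc.prems(3)])
  have "?F s (last h) (\<lambda>u'. nested_value P ?F (Suc s) (fst (\<pi> h)) u')
      = (\<Sum>u\<in>set_pmf ?R. ereal (pmf ?R u) * nested_value P ?F (Suc s) (fst (\<pi> h)) u)"
    using last_node Suc.prems s by (intro cond_expectation_eq) auto
  also have "\<dots> = (\<Sum>u\<in>set_pmf ?R. ereal (pmf ?R u) * ereal (cost_to_go \<pi> k (h @ [u])))"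
  proof (intro sum.cong refl)
    fix u assume "u \<in> set_pmf ?R"
    then have "h @ [u] \<in> set_pmf (node (Suc s))" using snoc_node s Suc.prems(3) by blast
    from Suc.IH[OF _ _ this] Suc.prems len
    show "ereal (pmf ?R u) * nested_value P ?F (Suc s) (fst (\<pi> h)) u
        = ereal (pmf ?R u) * ereal (cost_to_go \<pi> k (h @ [u]))"
      by (cases "h = []") (auto simp: incoming_snoc)
  qed
  also have "\<dots> = ereal (\<Sum>u\<in>set_pmf ?R. pmf ?R u * cost_to_go \<pi> k (h @ [u]))" by simp
  finally have eq: "?F s (last h) (\<lambda>u'. nested_value P ?F (Suc s) (fst (\<pi> h)) u') = \<dots>" .
  have "nested_value P ?F s (incoming P \<pi> h) (last h)
      = nested_objective P ?F s (last h) (fst (\<pi> h)) (snd (\<pi> h))"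
    using Suc.prems by (intro optimal_policy_node[OF assms(1)]) auto
  then show ?case using eq s len by (simp add: nested_objective_def node_cost_def del: set_map_pmf)
qed

lemma optimal_policy_minimizes_expected_cost:
  assumes "optimal_policy P M \<xi> (cond_expectation M \<xi>) \<pi>" "feasible_policy \<pi>'"
  shows "expected_sum {1..stages P} (node_cost \<pi>) \<le> expected_sum {1..stages P} (node_cost \<pi>')"
proof (cases "stages P")
  case 0
  then show ?thesis by (simp add: expected_sum_def)
next
  case (Suc k)
  then have k: "1 + k = stages P" by simp
  have "(\<Sum>h\<in>set_pmf (node 1). pmf (node 1) h * cost_to_go \<pi> k h)
      \<le> (\<Sum>h\<in>set_pmf (node 1). pmf (node 1) h * cost_to_go \<pi>' k h)"
  proof (intro sum_mono mult_left_mono)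
    fix h assume h: "h \<in> set_pmf (node 1)"
    \<comment> \<open>At stage 1 both policies start from the initial state, hence one nested value
      equals the cost of \<open>\<pi>\<close> and bounds that of \<open>\<pi>'\<close>.\<close>
    have "incoming P \<pi> h = incoming P \<pi>' h"
      using length_node[OF h] by (simp add: incoming_def)
    then have "ereal (cost_to_go \<pi> k h) \<le> ereal (cost_to_go \<pi>' k h)"
      using nested_value_eq_cost_to_go[OF assms(1) _ k h]
        nested_value_le_cost_to_go[OF assms(2) _ k h] by simp
    then show "cost_to_go \<pi> k h \<le> cost_to_go \<pi>' k h" by simp
  qed simp
  then show ?thesis using expected_cost_to_go[OF _ k] by simp
qed

end

subsection \<open>The constraints as affine conditions\<close>

text \<open>The componentwise combination \<open>a \<pi> + b \<pi>'\<close>, taking the role of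
  \<open>c\<close> in Farkas' lemma. Any real coefficients are allowed, so feasibility need not be
  preserved.\<close>

definition mix :: "real \<Rightarrow> 'n policy \<Rightarrow> real \<Rightarrow> 'n policy \<Rightarrow> 'n policy" where
  "mix a \<pi> b \<pi>' h =
    (let (x, v) = \<pi> h; (x', v') = \<pi>' h in
     (\<lparr>cap = \<lambda>ij. a * cap x ij + b * cap x' ij,
       dem = \<lambda>l o' d. a * dem x l o' d + b * dem x' l o' d\<rparr>,
      \<lparr>expansion = \<lambda>ij. a * expansion v ij + b * expansion v' ij,
       sav_flow = \<lambda>t ij. a * sav_flow v t ij + b * sav_flow v' t ij,
       deployed = \<lambda>i. a * deployed v i + b * deployed v' i,
       trav_flow = \<lambda>l t d ij. a * trav_flow v l t d ij + b * trav_flow v' l t d ij,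
       arrivals = \<lambda>l t d. a * arrivals v l t d + b * arrivals v' l t d\<rparr>))"

lemma affine_wrt_mix_components:
  "affine_wrt mix (\<lambda>\<pi>. cap (fst (\<pi> h)) ij)"
  "affine_wrt mix (\<lambda>\<pi>. dem (fst (\<pi> h)) l o' d)"
  "affine_wrt mix (\<lambda>\<pi>. expansion (snd (\<pi> h)) ij)"
  "affine_wrt mix (\<lambda>\<pi>. sav_flow (snd (\<pi> h)) t ij)"
  "affine_wrt mix (\<lambda>\<pi>. deployed (snd (\<pi> h)) i)"
  "affine_wrt mix (\<lambda>\<pi>. trav_flow (snd (\<pi> h)) l t d ij)"
  "affine_wrt mix (\<lambda>\<pi>. arrivals (snd (\<pi> h)) l t d)"
  by (auto simp: affine_wrt_def linear_wrt_def mix_def case_prod_beta Let_def intro!: exI[of _ 0])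

text \<open>At the first stage the incoming capacity is the fixed initial one, a constant; this is
  where affine rather than linear functionals are required.\<close>

lemma affine_wrt_mix_incoming: "affine_wrt mix (\<lambda>\<pi>. cap (incoming P \<pi> h) ij)"
  unfolding incoming_def
  by (cases "length h \<le> 1") (simp_all add: affine_wrt_const affine_wrt_mix_components)

lemma affine_wrt_mix_stage_cost:
  "affine_wrt mix (\<lambda>\<pi>. stage_cost P s (fst (\<pi> h)) (snd (\<pi> h)))"
  unfolding stage_cost_def strategic_cost_def operational_cost_def
  by (intro affine_wrt_intros affine_wrt_mix_components)

text \<open>
  The data \<open>pre_trav\<close> may depend on the demand in a nonlinear way. Since the demand transitions
  determine the demand at every node, it can be replaced by that of a fixed policy \<open>\<pi>\<^sub>0\<close>, which
  makes the constraints affine.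
\<close>

definition with_demand :: "'n policy \<Rightarrow> 'n policy \<Rightarrow> 'n policy" where
  "with_demand \<pi>\<^sub>0 \<pi> h = ((fst (\<pi> h))\<lparr>dem := dem (fst (\<pi>\<^sub>0 h))\<rparr>, snd (\<pi> h))"

text \<open>The constraints read the demand only at arrival steps in \<open>steps P\<close>, and the
  uniqueness result below fixes it only there.\<close>

lemma uncapacitated_feasible_cong:
  assumes "cap x\<^sub>0 = cap x\<^sub>0'" "cap x = cap x'"
    and "\<And>l. l \<in> steps P \<Longrightarrow> dem x\<^sub>0 l = dem x\<^sub>0' l" "\<And>l. l \<in> steps P \<Longrightarrow> dem x l = dem x' l"
  shows "uncapacitated_feasible P s x\<^sub>0 u x v \<longleftrightarrow> uncapacitated_feasible P s x\<^sub>0' u x' v"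
proof -
  have "trav_at P s (\<lambda>l o' d. dem x l o' d + u l o' d) v l t d ij =
      trav_at P s (\<lambda>l o' d. dem x' l o' d + u l o' d) v l t d ij" if "l \<in> steps P" for l t d ij
    using assms(4)[OF that] by (simp add: trav_at_def)
  then show ?thesis
    unfolding uncapacitated_feasible_def state_nonneg_def strategic_constraints_def
      operational_constraints_def
    using assms by simp
qed

context sav_tree
begin

lemma uncapacitated_policy_iff:
  "uncapacitated_policy P M \<xi> \<pi> \<longleftrightarrow> (\<forall>s\<in>{1..stages P}. \<forall>h\<in>set_pmf (node s).
     uncapacitated_feasible P s (incoming P \<pi> h) (last h) (fst (\<pi> h)) (snd (\<pi> h)))"
proof -
  have "last (node_at \<xi> s \<omega>) = \<xi> s \<omega>" if "s \<in> {1..stages P}" for s \<omega>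
    using that by (cases s) auto
  then show ?thesis by (simp add: uncapacitated_policy_def Let_def)
qed

text \<open>Both kinds of transition determine the new demand from the incoming one and the
  realization; the claim follows by induction along the tree from the common initial state.\<close>

lemma uncapacitated_policy_dem_unique:
  assumes "uncapacitated_policy P M \<xi> \<pi>" "uncapacitated_policy P M \<xi> \<pi>\<^sub>0"
    and "1 \<le> s" "s \<le> stages P" "h \<in> set_pmf (node s)" "l \<in> steps P"
  shows "dem (fst (\<pi> h)) l = dem (fst (\<pi>\<^sub>0 h)) l"
  using assms(3-5)
proof (induction s arbitrary: h)
  case 0
  then show ?case by simp
next
  case (Suc s)
  have "dem (incoming P \<pi> h) l = dem (incoming P \<pi>\<^sub>0 h) l"
  proof (cases "s = 0")
    case True
    then show ?thesis using length_node[OF Suc.prems(3)] by (simp add: incoming_def)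
  next
    case False
    obtain k u where h: "h = k @ [u]" "k \<in> set_pmf (node s)"
      using Suc.prems(3) by auto
    moreover have "k \<noteq> []" using length_node[OF h(2)] False by auto
    ultimately show ?thesis using Suc.IH[of k] Suc.prems False by (simp add: incoming_snoc)
  qed
  moreover have "Suc s \<in> {1..stages P}" using Suc.prems by simp
  then have
    "uncapacitated_feasible P (Suc s) (incoming P \<pi> h) (last h) (fst (\<pi> h)) (snd (\<pi> h))"
    "uncapacitated_feasible P (Suc s) (incoming P \<pi>\<^sub>0 h) (last h) (fst (\<pi>\<^sub>0 h)) (snd (\<pi>\<^sub>0 h))"
    using assms(1,2) Suc.prems(3) unfolding uncapacitated_policy_iff by blast+
  ultimately show ?case
    using assms(6)
    by (intro ext) (auto simp: uncapacitated_feasible_def strategic_constraints_def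
        operational_constraints_def split: if_splits)
qed

text \<open>Separates the feasible set into linear equations fixing the demand and constraints in
  which the demand is a constant. The equations are forced by uniqueness, and under them the
  replacement changes no constraint.\<close>

lemma uncapacitated_policy_with_demand:
  assumes "uncapacitated_policy P M \<xi> \<pi>\<^sub>0"
  shows "uncapacitated_policy P M \<xi> \<pi> \<longleftrightarrow>
    (\<forall>s\<in>{1..stages P}. \<forall>h\<in>set_pmf (node s). \<forall>l\<in>steps P. \<forall>o' d.
       dem (fst (\<pi> h)) l o' d = dem (fst (\<pi>\<^sub>0 h)) l o' d) \<and>
    uncapacitated_policy P M \<xi> (with_demand \<pi>\<^sub>0 \<pi>)" (is "_ \<longleftrightarrow> ?R \<and> _")
proof -
  have "uncapacitated_policy P M \<xi> \<pi> \<longleftrightarrow> uncapacitated_policy P M \<xi> (with_demand \<pi>\<^sub>0 \<pi>)"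
    if R: ?R
  proof -
    have eq: "dem (fst (\<pi> h)) l = dem (fst (\<pi>\<^sub>0 h)) l"
      if "s \<in> {1..stages P}" "h \<in> set_pmf (node s)" "l \<in> steps P" for s h l
      using R that by (intro ext) blast
    have "uncapacitated_feasible P s (incoming P \<pi> h) (last h) (fst (\<pi> h)) (snd (\<pi> h)) \<longleftrightarrow>
        uncapacitated_feasible P s (incoming P (with_demand \<pi>\<^sub>0 \<pi>) h) (last h)
          (fst (with_demand \<pi>\<^sub>0 \<pi> h)) (snd (with_demand \<pi>\<^sub>0 \<pi> h))"
      if sh: "s \<in> {1..stages P}" "h \<in> set_pmf (node s)" for s h
    proof -
      have "dem (incoming P \<pi> h) l = dem (incoming P (with_demand \<pi>\<^sub>0 \<pi>) h) l"
        if l: "l \<in> steps P" for l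
      proof (cases "length h \<le> 1")
        case True
        then show ?thesis by (simp add: incoming_def)
      next
        case False
        then obtain r where r: "s = Suc r" "1 \<le> r"
          using length_node[OF sh(2)] by (cases s) auto
        then obtain k u where k: "h = k @ [u]" "k \<in> set_pmf (node r)"
          using sh(2) by auto
        have "k \<noteq> []" using length_node[OF k(2)] r by auto
        then show ?thesis
          using eq[OF _ k(2) l] k(1) r sh(1) by (simp add: incoming_snoc with_demand_def)
      qed
      moreover have "cap (incoming P \<pi> h) = cap (incoming P (with_demand \<pi>\<^sub>0 \<pi>) h)"
        by (simp add: incoming_def with_demand_def)
      moreover have "snd (with_demand \<pi>\<^sub>0 \<pi> h) = snd (\<pi> h)"
        by (simp add: with_demand_def)
      ultimately show ?thesis
        using eq[OF sh]
        by (simp only:) (intro uncapacitated_feasible_cong; simp add: with_demand_def)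
    qed
    then show ?thesis unfolding uncapacitated_policy_iff by blast
  qed
  moreover have ?R if "uncapacitated_policy P M \<xi> \<pi>"
    using uncapacitated_policy_dem_unique[OF that assms] by (metis atLeastAtMost_iff)
  ultimately show ?thesis by blast
qed

lemma polyhedral_uncapacitated_policy:
  assumes "uncapacitated_policy P M \<xi> \<pi>\<^sub>0"
  shows "polyhedral_wrt mix (uncapacitated_policy P M \<xi>)"
proof -
  have fin: "finite (steps P)" "finite (arcs P)"
    by (simp_all add: steps_def)
  \<comment> \<open>These rewrites make every demand term, and so every value of
    \<open>pre_trav\<close>, independent of \<open>\<pi>\<close>.\<close>
  have incoming: "dem (incoming P (with_demand \<pi>\<^sub>0 \<pi>) h) = dem (incoming P \<pi>\<^sub>0 h)"
    "cap (incoming P (with_demand \<pi>\<^sub>0 \<pi>) h) = cap (incoming P \<pi> h)" for \<pi> h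
    by (simp_all add: incoming_def with_demand_def)
  have fst_snd: "dem (fst (with_demand \<pi>\<^sub>0 \<pi> h)) = dem (fst (\<pi>\<^sub>0 h))"
    "cap (fst (with_demand \<pi>\<^sub>0 \<pi> h)) = cap (fst (\<pi> h))"
    "snd (with_demand \<pi>\<^sub>0 \<pi> h) = snd (\<pi> h)" for \<pi> h
    by (simp_all add: with_demand_def)
  note aff = affine_wrt_intros affine_wrt_mix_components affine_wrt_mix_incoming
  have "polyhedral_wrt mix (\<lambda>\<pi>. uncapacitated_policy P M \<xi> (with_demand \<pi>\<^sub>0 \<pi>))"
    unfolding uncapacitated_policy_iff uncapacitated_feasible_def state_nonneg_def
      strategic_constraints_def operational_constraints_def sav_at_def trav_at_def
      incoming fst_snd
    by (intro polyhedral_wrt_intros aff fin finite_node finite_atLeastAtMost) auto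
  moreover have "polyhedral_wrt mix (\<lambda>\<pi>. \<forall>s\<in>{1..stages P}. \<forall>h\<in>set_pmf (node s).
      \<forall>l\<in>steps P. \<forall>o' d. dem (fst (\<pi> h)) l o' d = dem (fst (\<pi>\<^sub>0 h)) l o' d)"
    by (intro polyhedral_wrt_intros aff fin finite_node finite_atLeastAtMost) auto
  ultimately have "polyhedral_wrt mix (\<lambda>\<pi>. (\<forall>s\<in>{1..stages P}. \<forall>h\<in>set_pmf (node s).
      \<forall>l\<in>steps P. \<forall>o' d. dem (fst (\<pi> h)) l o' d = dem (fst (\<pi>\<^sub>0 h)) l o' d) \<and>
      uncapacitated_policy P M \<xi> (with_demand \<pi>\<^sub>0 \<pi>))"
    by (intro polyhedral_wrt_conj)
  then show ?thesis unfolding uncapacitated_policy_with_demand[OF assms, symmetric] .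
qed

subsection \<open>Duality\<close>

definition capacity_excess :: "'n policy \<Rightarrow> 'n node \<Rightarrow> int \<Rightarrow> 'n \<times> 'n \<Rightarrow> real" where
  "capacity_excess \<pi> h t ij = sav_flow (snd (\<pi> h)) t ij - cap (fst (\<pi> h)) ij"

lemma operational_subset: "operational P \<subseteq> {1..stages P}"
  by (auto simp: operational_def)

lemma strategic_subset: "strategic P \<subseteq> {1..stages P}"
  by (auto simp: strategic_def)

lemma feasible_policy_iff:
  "feasible_policy \<pi> \<longleftrightarrow> uncapacitated_policy P M \<xi> \<pi> \<and>
    (\<forall>s\<in>operational P. \<forall>h\<in>set_pmf (node s). \<forall>t\<in>steps P. \<forall>ij\<in>arcs P.
       capacity_excess \<pi> h t ij \<le> 0)"
  unfolding feasible_policy_def stage_feasible_def uncapacitated_policy_iff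
    capacity_constraint_def capacity_excess_def operational_def
  by (auto simp del: set_map_pmf)

lemma lagrangian_eq:
  "lagrangian P M \<xi> \<pi> p = expected_sum {1..stages P} (node_cost \<pi>) +
    expected_sum (operational P)
      (\<lambda>s h. \<Sum>t\<in>steps P. \<Sum>ij\<in>arcs P. p h t ij * capacity_excess \<pi> h t ij)"
  using expectation_eq_expected_sum[OF order_refl, of "node_cost \<pi>"]
    expectation_eq_expected_sum[OF operational_subset,
      of "\<lambda>s h. \<Sum>t\<in>steps P. \<Sum>ij\<in>arcs P. p h t ij * capacity_excess \<pi> h t ij"]
  by (simp add: lagrangian_def Let_def node_cost_def capacity_excess_def)

lemma dual_feasible_iff:
  "dual_feasible P M \<xi> p \<longleftrightarrow>
    (\<forall>s\<in>operational P. \<forall>h\<in>set_pmf (node s). \<forall>t\<in>steps P. \<forall>ij\<in>arcs P. 0 \<le> p h t ij)"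
  by (simp add: dual_feasible_def)

text \<open>Lagrange multipliers for the capacity constraints alone, one for each operational node,
  time step and arc; all other constraints form the polyhedral set.\<close>

lemma strong_duality:
  assumes feas: "feasible_policy \<pi>"
    and min: "\<And>\<pi>'. feasible_policy \<pi>' \<Longrightarrow>
      expected_sum {1..stages P} (node_cost \<pi>) \<le> expected_sum {1..stages P} (node_cost \<pi>')"
  obtains p where "dual_feasible P M \<xi> p"
    and "\<And>\<pi>'. uncapacitated_policy P M \<xi> \<pi>' \<Longrightarrow>
      expected_sum {1..stages P} (node_cost \<pi>) \<le> lagrangian P M \<xi> \<pi>' p"
proof -
  define N where "N = (SIGMA s:operational P. set_pmf (node s))"
  define K where "K = N \<times> steps P \<times> arcs P"
  define f where "f = (\<lambda>((s::nat, h), t, ij) \<pi>'. capacity_excess \<pi>' h t ij)"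
  have fin: "finite (set_pmf (node s))" if "s \<in> operational P" for s
    using finite_node that by (simp add: operational_def del: set_map_pmf)
  have "finite N" unfolding N_def
    using fin by (intro finite_SigmaI) (simp_all add: operational_def)
  then have "finite K" by (simp add: K_def steps_def)
  moreover have "affine_wrt mix (f k)" for k
    unfolding f_def capacity_excess_def case_prod_beta
    by (intro affine_wrt_diff affine_wrt_mix_components)
  moreover have "affine_wrt mix (\<lambda>\<pi>'. expected_sum {1..stages P} (node_cost \<pi>'))"
    unfolding expected_sum_def node_cost_def
    by (intro affine_wrt_sum affine_wrt_cmult affine_wrt_mix_stage_cost)
  moreover have K_iff: "feasible_policy \<pi>' \<longleftrightarrow>
      uncapacitated_policy P M \<xi> \<pi>' \<and> (\<forall>k\<in>K. f k \<pi>' \<le> 0)" for \<pi>'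
    unfolding feasible_policy_iff K_def f_def N_def by (auto simp del: set_map_pmf)
  moreover have "polyhedral_wrt mix (uncapacitated_policy P M \<xi>)"
    using polyhedral_uncapacitated_policy feas feasible_policy_iff by blast
  ultimately obtain w where w: "\<forall>k\<in>K. 0 \<le> w k"
    "\<And>\<pi>'. uncapacitated_policy P M \<xi> \<pi>' \<Longrightarrow> expected_sum {1..stages P} (node_cost \<pi>)
      \<le> expected_sum {1..stages P} (node_cost \<pi>') + (\<Sum>k\<in>K. w k * f k \<pi>')"
    using lagrange_multipliers_exist[of mix "uncapacitated_policy P M \<xi>" K f
        "\<lambda>\<pi>'. expected_sum {1..stages P} (node_cost \<pi>')" \<pi>
        "expected_sum {1..stages P} (node_cost \<pi>)"] feas min by blast
  \<comment> \<open>Division by the node probability, positive on the tree, cancels the weight in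
    \<open>expected_sum\<close>. The stage is recovered as the length of the node.\<close>
  define p where "p h t ij = w ((length h, h), t, ij) / pmf (node (length h)) h" for h t ij
  have "expected_sum (operational P)
      (\<lambda>s h. \<Sum>t\<in>steps P. \<Sum>ij\<in>arcs P. p h t ij * capacity_excess \<pi>' h t ij)
      = (\<Sum>k\<in>K. w k * f k \<pi>')" for \<pi>'
  proof -
    have "pmf (node s) h * (\<Sum>t\<in>steps P. \<Sum>ij\<in>arcs P. p h t ij * capacity_excess \<pi>' h t ij)
        = (\<Sum>t\<in>steps P. \<Sum>ij\<in>arcs P. w ((s, h), t, ij) * f ((s, h), t, ij) \<pi>')"
      if "h \<in> set_pmf (node s)" for s h
      using length_node[OF that] that
      unfolding sum_distrib_left p_def f_def set_pmf_iff by (intro sum.cong refl) simp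
    then have "expected_sum (operational P)
        (\<lambda>s h. \<Sum>t\<in>steps P. \<Sum>ij\<in>arcs P. p h t ij * capacity_excess \<pi>' h t ij)
        = (\<Sum>s\<in>operational P. \<Sum>h\<in>set_pmf (node s).
            \<Sum>t\<in>steps P. \<Sum>ij\<in>arcs P. w ((s, h), t, ij) * f ((s, h), t, ij) \<pi>')"
      unfolding expected_sum_def by (intro sum.cong refl) simp
    also have "\<dots> = (\<Sum>sh\<in>N. \<Sum>t\<in>steps P. \<Sum>ij\<in>arcs P. w (sh, t, ij) * f (sh, t, ij) \<pi>')"
      unfolding N_def using fin
      by (subst sum.Sigma) (auto simp: operational_def case_prod_beta simp del: set_map_pmf)
    also have "\<dots> = (\<Sum>k\<in>K. w k * f k \<pi>')"
      unfolding K_def by (simp add: sum.cartesian_product case_prod_beta)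
    finally show ?thesis .
  qed
  then have "expected_sum {1..stages P} (node_cost \<pi>) \<le> lagrangian P M \<xi> \<pi>' p"
    if "uncapacitated_policy P M \<xi> \<pi>'" for \<pi>'
    using w(2)[OF that] by (simp add: lagrangian_eq)
  moreover have "0 \<le> p h t ij"
    if "s \<in> operational P" "h \<in> set_pmf (node s)" "t \<in> steps P" "ij \<in> arcs P" for s h t ij
  proof -
    have "((length h, h), t, ij) \<in> K"
      using that length_node[OF that(2)] by (simp add: K_def N_def del: set_map_pmf)
    then show ?thesis using w(1) unfolding p_def by (meson divide_nonneg_nonneg pmf_nonneg)
  qed
  then have "dual_feasible P M \<xi> p" unfolding dual_feasible_iff by blast
  ultimately show ?thesis using that by blast
qed

text \<open>Strong duality provides one multiplier whose dual value reaches the primal optimum; an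
  optimal \<open>p\<close> has at least that dual value, which bounds the Lagrangian from
  below.\<close>

lemma optimal_dual_bound:
  assumes primal: "optimal_policy P M \<xi> (cond_expectation M \<xi>) \<pi>"
    and dual: "optimal_dual P M \<xi> p" and U: "uncapacitated_policy P M \<xi> \<pi>'"
  shows "expected_sum {1..stages P} (node_cost \<pi>) \<le> lagrangian P M \<xi> \<pi>' p"
proof -
  have "feasible_policy \<pi>"
    by (rule optimal_policy_feasible[OF primal])
  then obtain p\<^sub>0 where p0: "dual_feasible P M \<xi> p\<^sub>0"
    "\<And>\<pi>'. uncapacitated_policy P M \<xi> \<pi>' \<Longrightarrow>
      expected_sum {1..stages P} (node_cost \<pi>) \<le> lagrangian P M \<xi> \<pi>' p\<^sub>0"
    using strong_duality optimal_policy_minimizes_expected_cost[OF primal] by blast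
  have "ereal (expected_sum {1..stages P} (node_cost \<pi>)) \<le> dual_function P M \<xi> p\<^sub>0"
    unfolding dual_function_def using p0(2) by (intro INF_greatest) auto
  also have "\<dots> \<le> dual_function P M \<xi> p"
    using dual p0(1) by (auto simp: optimal_dual_def is_arg_max_def not_less)
  also have "\<dots> \<le> ereal (lagrangian P M \<xi> \<pi>' p)"
    unfolding dual_function_def using U by (intro INF_lower) auto
  finally show ?thesis by simp
qed

text \<open>At \<open>\<pi>\<close> the penalty is a sum of nonpositive terms, yet the Lagrangian is
  at least the optimal cost. So the penalty is zero, and so is every term of it.\<close>

lemma complementary_slackness:
  assumes primal: "optimal_policy P M \<xi> (cond_expectation M \<xi>) \<pi>"
    and dual: "optimal_dual P M \<xi> p"
  shows "lagrangian P M \<xi> \<pi> p = expected_sum {1..stages P} (node_cost \<pi>)"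
    and "\<And>s h t ij. \<lbrakk>s \<in> operational P; h \<in> set_pmf (node s); t \<in> steps P; ij \<in> arcs P\<rbrakk> \<Longrightarrow>
      p h t ij * capacity_excess \<pi> h t ij = 0"
proof -
  define G where
    "G s h = (\<Sum>t\<in>steps P. \<Sum>ij\<in>arcs P. p h t ij * capacity_excess \<pi> h t ij)" for s :: nat and h
  have feas: "feasible_policy \<pi>"
    by (rule optimal_policy_feasible[OF primal])
  have fin: "finite (operational P)" "finite (steps P)" "finite (arcs P)"
    by (auto simp: operational_def steps_def)
  have fin_node: "finite (set_pmf (node s))" if "s \<in> operational P" for s
    using finite_node that by (auto simp: operational_def)
  have term_le: "p h t ij * capacity_excess \<pi> h t ij \<le> 0"
    if "s \<in> operational P" "h \<in> set_pmf (node s)" "t \<in> steps P" "ij \<in> arcs P" for s h t ij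
    using feas dual that unfolding feasible_policy_iff optimal_dual_def is_arg_max_def dual_feasible_iff
    by (meson mult_nonneg_nonpos)
  then have inner_le: "(\<Sum>ij\<in>arcs P. p h t ij * capacity_excess \<pi> h t ij) \<le> 0"
    if "s \<in> operational P" "h \<in> set_pmf (node s)" "t \<in> steps P" for s h t
    using that by (meson sum_nonpos)
  then have G_le: "G s h \<le> 0" if "s \<in> operational P" "h \<in> set_pmf (node s)" for s h
    unfolding G_def using that by (meson sum_nonpos)
  then have qG_le: "pmf (node s) h * G s h \<le> 0"
    if "s \<in> operational P" "h \<in> set_pmf (node s)" for s h
    using that by (meson mult_nonneg_nonpos pmf_nonneg)
  then have node_le: "(\<Sum>h\<in>set_pmf (node s). pmf (node s) h * G s h) \<le> 0"
    if "s \<in> operational P" for s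
    using that by (meson sum_nonpos)
  then have "expected_sum (operational P) G \<le> 0"
    unfolding expected_sum_def by (meson sum_nonpos)
  moreover have L: "lagrangian P M \<xi> \<pi> p
      = expected_sum {1..stages P} (node_cost \<pi>) + expected_sum (operational P) G"
    unfolding lagrangian_eq G_def ..
  moreover have "expected_sum {1..stages P} (node_cost \<pi>) \<le> lagrangian P M \<xi> \<pi> p"
    using optimal_dual_bound[OF primal dual] feas feasible_policy_iff by blast
  ultimately have G0: "expected_sum (operational P) G = 0" by linarith
  then show "lagrangian P M \<xi> \<pi> p = expected_sum {1..stages P} (node_cost \<pi>)"
    using L by simp
  fix s h t ij
  assume s: "s \<in> operational P" and h: "h \<in> set_pmf (node s)"
    and t: "t \<in> steps P" and ij: "ij \<in> arcs P"
  have "(\<Sum>h\<in>set_pmf (node s). pmf (node s) h * G s h) = 0"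
    by (rule sum_nonpos_eq_0D[OF fin(1) G0[unfolded expected_sum_def] s]) (rule node_le)
  from sum_nonpos_eq_0D[OF fin_node[OF s] this h] have "pmf (node s) h * G s h = 0"
    using qG_le[OF s] by blast
  \<comment> \<open>Nodes in the support have positive probability, so the weight can be
    cancelled.\<close>
  then have "G s h = 0" using h by (simp only: set_pmf_iff mult_eq_0_iff simp_thms)
  from sum_nonpos_eq_0D[OF fin(2) this[unfolded G_def] t]
  have "(\<Sum>ij\<in>arcs P. p h t ij * capacity_excess \<pi> h t ij) = 0"
    using inner_le[OF s h] by blast
  from sum_nonpos_eq_0D[OF fin(3) this ij] show "p h t ij * capacity_excess \<pi> h t ij = 0"
    using term_le[OF s h t] by blast
qed

lemma expected_sum_add_scaled:
  "expected_sum A (\<lambda>s h. f s h + r * g s h) = expected_sum A f + r * expected_sum A g"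
  unfolding expected_sum_def sum_distrib_left sum.distrib[symmetric]
  by (intro sum.cong refl) (simp add: algebra_simps)

lemma expected_sum_strategic:
  "expected_sum {1..stages P} (\<lambda>s h. if odd s then f s h else 0) = expected_sum (strategic P) f"
proof -
  have "expected_sum (strategic P) f =
      (\<Sum>s\<in>{1..stages P}. if odd s then \<Sum>h\<in>set_pmf (node s). pmf (node s) h * f s h else 0)"
    unfolding expected_sum_def strategic_def by (rule sum.inter_filter) simp
  then show ?thesis unfolding expected_sum_def by (auto intro!: sum.cong)
qed

end

subsection \<open>Scaling the capacity of an arc\<close>

text \<open>Flows stay unchanged, so the scaled policy may violate the capacity constraint; it is
  compared with \<open>\<pi>\<close> through the Lagrangian only.\<close>

definition scale_capacity :: "real \<Rightarrow> 'n \<times> 'n \<Rightarrow> 'n policy \<Rightarrow> 'n policy" where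
  "scale_capacity r ij \<pi> h =
    ((fst (\<pi> h))\<lparr>cap := \<lambda>b. (if b = ij then r else 1) * cap (fst (\<pi> h)) b\<rparr>,
     (snd (\<pi> h))\<lparr>expansion := \<lambda>b. (if b = ij then r else 1) * expansion (snd (\<pi> h)) b\<rparr>)"

context sav_tree
begin

text \<open>With zero initial capacity the transitions of the capacity of \<open>ij\<close> are
  homogeneous, and \<open>0 \<le> r\<close> preserves signs. The flow constraints do not involve
  capacities.\<close>

lemma uncapacitated_policy_scale_capacity:
  assumes "uncapacitated_policy P M \<xi> \<pi>" "0 \<le> r" "cap (init_state P) ij = 0"
  shows "uncapacitated_policy P M \<xi> (scale_capacity r ij \<pi>)"
proof -
  have "cap (incoming P (scale_capacity r ij \<pi>) h) b
      = (if b = ij then r else 1) * cap (incoming P \<pi> h) b"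
    "dem (incoming P (scale_capacity r ij \<pi>) h) = dem (incoming P \<pi> h)" for h b
    using assms(3) by (auto simp: incoming_def scale_capacity_def)
  then have "uncapacitated_feasible P s (incoming P (scale_capacity r ij \<pi>) h) u
      (fst (scale_capacity r ij \<pi> h)) (snd (scale_capacity r ij \<pi> h))"
    if "uncapacitated_feasible P s (incoming P \<pi> h) u (fst (\<pi> h)) (snd (\<pi> h))" for s h u
    using that assms(2)
    by (auto simp: uncapacitated_feasible_def state_nonneg_def strategic_constraints_def
        operational_constraints_def sav_at_def trav_at_def scale_capacity_def distrib_left
        cong: if_cong)
  then show ?thesis using assms(1) unfolding uncapacitated_policy_iff by blast
qed

text \<open>Capacity and expansion of \<open>ij\<close> enter linearly through the infrastructure
  costs and, with negative sign, through the penalty; the bracket is the slope in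
  \<open>r\<close>.\<close>

lemma lagrangian_scale_capacity:
  assumes ij: "ij \<in> arcs P"
  shows "lagrangian P M \<xi> (scale_capacity r ij \<pi>) p = lagrangian P M \<xi> \<pi> p + (r - 1) *
    (expected_sum (strategic P) (\<lambda>s h. maint_cost P s ij * cap (fst (\<pi> h)) ij
        + exp_cost P s ij * expansion (snd (\<pi> h)) ij)
     - expected_sum (operational P) (\<lambda>s h. \<Sum>t\<in>steps P. p h t ij * cap (fst (\<pi> h)) ij))"
proof -
  let ?\<pi> = "scale_capacity r ij \<pi>"
  let ?c = "\<lambda>s h. maint_cost P s ij * cap (fst (\<pi> h)) ij
        + exp_cost P s ij * expansion (snd (\<pi> h)) ij"
  have fin: "finite (arcs P)" by simp
  have node_cost: "node_cost ?\<pi> s h = node_cost \<pi> s h + (r - 1) * (if odd s then ?c s h else 0)" for s h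
  proof (cases "odd s")
    case True
    have "strategic_cost P s (fst (?\<pi> h)) (snd (?\<pi> h))
        = strategic_cost P s (fst (\<pi> h)) (snd (\<pi> h)) + (r - 1) * ?c s h"
      unfolding strategic_cost_def
      by (subst sum_change_one[OF fin ij, where f = "\<lambda>b. exp_cost P s b * expansion (snd (\<pi> h)) b
            + maint_cost P s b * cap (fst (\<pi> h)) b"])
        (simp_all add: scale_capacity_def algebra_simps)
    then show ?thesis using True by (simp add: node_cost_def stage_cost_def)
  next
    case False
    then show ?thesis
      by (simp add: node_cost_def stage_cost_def operational_cost_def scale_capacity_def)
  qed
  have "(\<Sum>b\<in>arcs P. p h t b * capacity_excess ?\<pi> h t b)
      = (\<Sum>b\<in>arcs P. p h t b * capacity_excess \<pi> h t b)
        + (1 - r) * (p h t ij * cap (fst (\<pi> h)) ij)" for h t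
    by (subst sum_change_one[OF fin ij, where f = "\<lambda>b. p h t b * capacity_excess \<pi> h t b"])
      (simp_all add: scale_capacity_def capacity_excess_def algebra_simps)
  then have excess: "(\<Sum>t\<in>steps P. \<Sum>b\<in>arcs P. p h t b * capacity_excess ?\<pi> h t b)
      = (\<Sum>t\<in>steps P. \<Sum>b\<in>arcs P. p h t b * capacity_excess \<pi> h t b)
        + (1 - r) * (\<Sum>t\<in>steps P. p h t ij * cap (fst (\<pi> h)) ij)" for h
    by (simp add: sum.distrib sum_distrib_left)
  have "expected_sum {1..stages P} (node_cost ?\<pi>) =
      expected_sum {1..stages P} (node_cost \<pi>) + (r - 1) * expected_sum (strategic P) ?c"
    unfolding expected_sum_strategic[symmetric] expected_sum_add_scaled[symmetric]
      node_cost[abs_def] ..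
  moreover have "expected_sum (operational P)
        (\<lambda>s h. \<Sum>t\<in>steps P. \<Sum>b\<in>arcs P. p h t b * capacity_excess ?\<pi> h t b)
      = expected_sum (operational P)
          (\<lambda>s h. \<Sum>t\<in>steps P. \<Sum>b\<in>arcs P. p h t b * capacity_excess \<pi> h t b)
        + (1 - r) * expected_sum (operational P)
          (\<lambda>s h. \<Sum>t\<in>steps P. p h t ij * cap (fst (\<pi> h)) ij)"
    unfolding excess expected_sum_add_scaled ..
  ultimately show ?thesis
    unfolding lagrangian_eq by (simp add: left_diff_distrib right_diff_distrib)
qed

end

section \<open>Balance of infrastructure costs and payments\<close>

theorem proposition4:
  fixes P :: "'n::finite sav_model"
    and M :: "'w pmf"
    and \<xi> :: "nat \<Rightarrow> 'w \<Rightarrow> 'n demand"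
    and F :: "'n risk_measure"
    and \<pi> :: "'n policy"
    and p :: "'n multiplier"
  assumes finite_realizations: "\<forall>s\<in>{1..stages P}. finite (\<xi> s ` set_pmf M)"
    and first_given: "\<exists>u. \<forall>\<omega>\<in>set_pmf M. \<xi> 1 \<omega> = u"
    and stagewise_independent:
      "prob_space.indep_vars (measure_pmf M) (\<lambda>_. count_space UNIV) \<xi> {1..stages P}"
    and risk_neutral: "F = cond_expectation M \<xi>"
    and primal: "optimal_policy P M \<xi> F \<pi>"
    and dual: "optimal_dual P M \<xi> p"
    and arc: "ij \<in> arcs P"
    and no_initial_capacity: "cap (init_state P) ij = 0"
  shows "measure_pmf.expectation M (\<lambda>\<omega>. \<Sum>s\<in>strategic P.
           maint_cost P s ij * cap (fst (\<pi> (node_at \<xi> s \<omega>))) ij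
           + exp_cost P s ij * expansion (snd (\<pi> (node_at \<xi> s \<omega>))) ij)
         = measure_pmf.expectation M (\<lambda>\<omega>. \<Sum>s\<in>operational P. \<Sum>t\<in>steps P.
           p (node_at \<xi> s \<omega>) t ij * sav_flow (snd (\<pi> (node_at \<xi> s \<omega>))) t ij)"
proof -
  interpret sav_tree P M \<xi>
    using finite_realizations stagewise_independent by unfold_locales auto
  have primal': "optimal_policy P M \<xi> (cond_expectation M \<xi>) \<pi>"
    using primal risk_neutral by simp
  define E where "E = expected_sum (strategic P)
    (\<lambda>s h. maint_cost P s ij * cap (fst (\<pi> h)) ij + exp_cost P s ij * expansion (snd (\<pi> h)) ij)"
  define R where "R = expected_sum (operational P)
    (\<lambda>s h. \<Sum>t\<in>steps P. p h t ij * cap (fst (\<pi> h)) ij)"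
  have U: "uncapacitated_policy P M \<xi> \<pi>"
    using optimal_policy_feasible[OF primal'] feasible_policy_iff by blast
  \<comment> \<open>The Lagrangian at \<open>\<pi>\<close> equals the optimal cost, which bounds it
    below at every scaled policy, so the change under scaling is nonnegative.\<close>
  have "0 \<le> (r - 1) * (E - R)" if "0 \<le> r" for r
    using optimal_dual_bound[OF primal' dual
        uncapacitated_policy_scale_capacity[OF U that no_initial_capacity]]
      lagrangian_scale_capacity[OF arc, of r \<pi> p] complementary_slackness(1)[OF primal' dual]
    by (simp add: E_def R_def)
  \<comment> \<open>Removing the arc (\<open>r = 0\<close>) gives \<open>E \<le> R\<close>, doubling
    it (\<open>r = 2\<close>) gives \<open>R \<le> E\<close>.\<close>
  from this[of 0] this[of 2] have "E = R" by simp
  \<comment> \<open>Complementary slackness: wherever \<open>p\<close> is nonzero, the flow fills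
    the capacity.\<close>
  moreover have "(\<Sum>t\<in>steps P. p h t ij * cap (fst (\<pi> h)) ij)
      = (\<Sum>t\<in>steps P. p h t ij * sav_flow (snd (\<pi> h)) t ij)"
    if "s \<in> operational P" "h \<in> set_pmf (node s)" for s h
    using complementary_slackness(2)[OF primal' dual that _ arc]
    by (intro sum.cong refl) (fastforce simp: capacity_excess_def)
  then have "R = expected_sum (operational P)
      (\<lambda>s h. \<Sum>t\<in>steps P. p h t ij * sav_flow (snd (\<pi> h)) t ij)"
    unfolding R_def expected_sum_def by (intro sum.cong refl) simp
  ultimately show ?thesis
    using expectation_eq_expected_sum[OF strategic_subset,
        of "\<lambda>s h. maint_cost P s ij * cap (fst (\<pi> h)) ij + exp_cost P s ij * expansion (snd (\<pi> h)) ij"]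
      expectation_eq_expected_sum[OF operational_subset,
        of "\<lambda>s h. \<Sum>t\<in>steps P. p h t ij * sav_flow (snd (\<pi> h)) t ij"]
    unfolding E_def by simp
qed

end
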